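(* Let $X$ be a complex finite dimensional Banach space, $L$ a complex nilpotent finite dimensional Lie algebra with $n=\dim L$, and $\rho\colon L\to L(X)$ a representation of $L$ in $X$. Then, for every $k=0,\ldots,n$, $$\sigma(\rho)=\sigma_{\delta,k}(\rho)=\sigma_{\pi,k}(\rho)=\{f\in L^*: f(L^2)=0, \text{ and there is } x\in X,\ x\neq 0, \text{ such that } \rho(l)x=f(l)x \text{ for all } l\in L\}.$$
   Context: $L(X)$ is the algebra of all bounded linear operators on the complex Banach space $X$. $L^*$ is the (linear) dual of the Lie algebra $L$, and $L^2=\{[x,y]: x,y\in L\}$. A representation $\rho\colon L\to L(X)$ is a Lie algebra homomorphism (with $L(X)$ carrying the commutator bracket). $R(T)$ denotes the range of an operator $T$. Koszul complex: for a representation $\rho$ of a complex solvable finite dimensional Lie algebra $L$, $n=\dim L$, the complex $(X\otimes\wedge L,d(\rho))$ has spaces $X\otimes\wedge^pL$ (with the Banach space topology of a finite direct sum of copies of $X$) and maps $d_p(\rho)\colon X\otimes\wedge^pL\to X\otimes\wedge^{p-1}L$, $$d_p(\rho)(x\otimes\langle l_1\wedge\dots\wedge l_p\rangle)=\sum_{k=1}^p(-1)^{k+1}\rho(l_k)(x)\otimes\langle l_1\wedge\ldots\wedge\hat{l_k}\wedge\ldots\wedge l_p\rangle+\sum_{1\le i<j\le p}(-1)^{i+j-1}x\otimes\langle[l_i,l_j]\wedge l_1\wedge\ldots\wedge\hat{l_i}\wedge\ldots\wedge\hat{l_j}\wedge\ldots\wedge l_p\rangle,$$ where $\hat{\ }$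 means deletion, and $d_p(\rho)=0$ for $p\le 0$ or $p\ge n+1$. For a character $f$ of $L$ (i.e. $f\in L^*$ with $f(L^2)=0$), $\rho-f$ denotes the representation $l\mapsto\rho(l)-f(l)I$, $I$ being the identity of $X$. $H_p(X\otimes\wedge L,d(\rho-f))$ is the $p$-th homology of the corresponding Koszul complex (kernel of $d_p(\rho-f)$ modulo range of $d_{p+1}(\rho-f)$). Set $\sigma_p(\rho)=\{f\in L^*: f(L^2)=0,\ H_p(X\otimes\wedge L,d(\rho-f))\neq 0\}$. Taylor joint spectrum: $\sigma(\rho)=\bigcup_{p=0}^n\sigma_p(\rho)$. Słodkowski joint spectra, for $k=0,\ldots,n$: $\sigma_{\delta,k}(\rho)=\bigcup_{p=0}^k\sigma_p(\rho)$ and $\sigma_{\pi,k}(\rho)=\bigcup_{p=n-k}^n\sigma_p(\rho)\cup\{f\in L^*: f(L^2)=0,\ R(d_{n-k}(\rho-f))\text{ is not closed}\}$. *)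

theory Defs
  imports "HOL-Analysis.Analysis" "Jordan_Normal_Form.Determinant"
begin

section \<open>Complex Banach spaces and complex Lie algebras\<close>

class complex_vector = ab_group_add +
  fixes scaleC :: "complex \<Rightarrow> 'a \<Rightarrow> 'a"  (infixr \<open>*\<^sub>C\<close> 75)
  assumes scaleC_add_right: "a *\<^sub>C (x + y) = a *\<^sub>C x + a *\<^sub>C y"
    and scaleC_add_left: "(a + b) *\<^sub>C x = a *\<^sub>C x + b *\<^sub>C x"
    and scaleC_scaleC: "a *\<^sub>C (b *\<^sub>C x) = (a * b) *\<^sub>C x"
    and scaleC_one: "1 *\<^sub>C x = x"

class complex_banach = complex_vector + banach +
  assumes scaleR_scaleC: "r *\<^sub>R x = complex_of_real r *\<^sub>C x"
    and norm_scaleC: "norm (a *\<^sub>C x) = cmod a * norm x"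

class complex_lie_algebra = complex_vector +
  fixes bracket :: "'a \<Rightarrow> 'a \<Rightarrow> 'a"
  assumes bracket_add_left: "bracket (x + y) z = bracket x z + bracket y z"
    and bracket_scaleC_left: "bracket (a *\<^sub>C x) z = a *\<^sub>C bracket x z"
    and bracket_add_right: "bracket x (y + z) = bracket x y + bracket x z"
    and bracket_scaleC_right: "bracket x (a *\<^sub>C z) = a *\<^sub>C bracket x z"
    and bracket_self: "bracket x x = 0"
    and jacobi: "bracket x (bracket y z) + bracket y (bracket z x) + bracket z (bracket x y) = 0"

interpretation cvec: vector_space "scaleC :: complex \<Rightarrow> 'a \<Rightarrow> 'a::complex_vector"
  by unfold_locales
    (rule scaleC_add_right scaleC_add_left scaleC_scaleC scaleC_one)+

definition finite_dimensional :: "'a::complex_vector itself \<Rightarrow> bool" where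
  "finite_dimensional _ \<longleftrightarrow> (\<exists>B :: 'a set. finite B \<and> cvec.span B = UNIV)"

definition cdim :: "'a::complex_vector itself \<Rightarrow> nat" where
  "cdim _ = cvec.dim (UNIV :: 'a set)"

fun lower_central :: "nat \<Rightarrow> 'l::complex_lie_algebra set" where
  "lower_central 0 = UNIV"
| "lower_central (Suc i) = cvec.span {bracket x y | x y. y \<in> lower_central i}"

definition nilpotent :: "'l::complex_lie_algebra itself \<Rightarrow> bool" where
  "nilpotent _ \<longleftrightarrow> (\<exists>i. lower_central i = {0 :: 'l})"

text \<open>Operators are plain functions; \<open>L(X)\<close> is the set of bounded complex-linear ones.\<close>

definition operators :: "('x::complex_banach \<Rightarrow> 'x) set" where
  "operators = {T. bounded_linear T \<and> (\<forall>a x. T (a *\<^sub>C x) = a *\<^sub>C T x)}"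

definition representation :: "('l::complex_lie_algebra \<Rightarrow> 'x::complex_banach \<Rightarrow> 'x) \<Rightarrow> bool" where
  "representation \<rho> \<longleftrightarrow>
     (\<forall>l. \<rho> l \<in> operators) \<and>
     (\<forall>l m x. \<rho> (l + m) x = \<rho> l x + \<rho> m x) \<and>
     (\<forall>a l x. \<rho> (a *\<^sub>C l) x = a *\<^sub>C \<rho> l x) \<and>
     (\<forall>l m x. \<rho> (bracket l m) x = \<rho> l (\<rho> m x) - \<rho> m (\<rho> l x))"

definition characters :: "('l::complex_lie_algebra \<Rightarrow> complex) set" where
  "characters = {f. Vector_Spaces.linear scaleC (*) f \<and> (\<forall>t \<in> {bracket x y | x y. True}. f t = 0)}"

section \<open>The Koszul complex\<close>

text \<open>
  Fix an ordered basis \<open>e 0, \<dots>, e (n - 1)\<close> of \<open>L\<close>, \<open>n = dim L\<close>. For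
  \<open>I = {i\<^sub>1 < \<dots> < i\<^sub>p} \<subseteq> {..<n}\<close> write \<open>e I = e i\<^sub>1 \<and> \<dots> \<and> e i\<^sub>p\<close>; these elements form a basis of
  \<open>\<and>\<^sup>p L\<close>. The space \<open>X \<otimes> \<and>\<^sup>p L\<close> is realised as the finite direct sum of copies of \<open>X\<close> indexed by
  the sets \<open>I\<close>: a function \<open>u\<close> stands for the sum of the \<open>u I \<otimes> e I\<close>, and \<open>u\<close> vanishes outside
  the \<open>p\<close>-element subsets of \<open>{..<n}\<close>.
\<close>

definition lie_basis :: "nat \<Rightarrow> 'l::complex_lie_algebra" where
  "lie_basis = (SOME e. inj_on e {..<cdim TYPE('l)} \<and>
      cvec.independent (e ` {..<cdim TYPE('l)}) \<and> cvec.span (e ` {..<cdim TYPE('l)}) = UNIV)"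

definition coord :: "'l::complex_lie_algebra \<Rightarrow> nat \<Rightarrow> complex" where
  "coord l i = cvec.representation (lie_basis ` {..<cdim TYPE('l)}) l (lie_basis i)"

definition indices :: "'l::complex_lie_algebra itself \<Rightarrow> nat \<Rightarrow> nat set set" where
  "indices _ p = {I. I \<subseteq> {..<cdim TYPE('l)} \<and> card I = p}"

definition koszul_space ::
    "'l::complex_lie_algebra itself \<Rightarrow> nat \<Rightarrow> (nat set \<Rightarrow> 'x::complex_banach) set" where
  "koszul_space _ p = {u. \<forall>I. I \<notin> indices TYPE('l) p \<longrightarrow> u I = 0}"

text \<open>
  The element \<open>x \<otimes> \<langle>l\<^sub>1 \<and> \<dots> \<and> l\<^sub>p\<rangle>\<close>, for arbitrary vectors \<open>l\<^sub>1, \<dots>, l\<^sub>p\<close>: the coefficient of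
  \<open>l\<^sub>1 \<and> \<dots> \<and> l\<^sub>p\<close> at \<open>e I\<close> is the minor of the coordinate matrix with columns \<open>I\<close>.
\<close>

definition tensor_wedge ::
    "'x::complex_banach \<Rightarrow> 'l::complex_lie_algebra list \<Rightarrow> nat set \<Rightarrow> 'x" where
  "tensor_wedge x ls = (\<lambda>I. if I \<in> indices TYPE('l) (length ls)
     then Determinant.det (mat (length ls) (length ls)
            (\<lambda>(a, b). coord (ls ! a) (sorted_list_of_set I ! b))) *\<^sub>C x
     else 0)"

text \<open>
  The value prescribed for \<open>d\<^sub>p (x \<otimes> \<langle>l\<^sub>1 \<and> \<dots> \<and> l\<^sub>p\<rangle>)\<close>. Positions in a list start at \<open>0\<close>, hence
  the signs \<open>(-1)^k\<close> and \<open>(-1)^(i + j + 1)\<close> where counting from \<open>1\<close> gives \<open>(-1)^(k + 1)\<close> and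
  \<open>(-1)^(i + j - 1)\<close>. \<open>nths ls (- S)\<close> deletes the entries of \<open>ls\<close> at the positions in \<open>S\<close>.
\<close>

definition koszul_formula ::
    "('l::complex_lie_algebra \<Rightarrow> 'x::complex_banach \<Rightarrow> 'x) \<Rightarrow> 'x \<Rightarrow> 'l list \<Rightarrow> nat set \<Rightarrow> 'x" where
  "koszul_formula \<rho> x ls = (\<lambda>J.
     (\<Sum>k<length ls. (-1) ^ k *\<^sub>C tensor_wedge (\<rho> (ls ! k) x) (nths ls (- {k})) J) +
     (\<Sum>j<length ls. \<Sum>i<j.
        (-1) ^ (i + j + 1) *\<^sub>C tensor_wedge x (bracket (ls ! i) (ls ! j) # nths ls (- {i, j})) J))"

text \<open>The linear map with these values on the elements \<open>x \<otimes> e I\<close>, and \<open>0\<close> unless \<open>1 \<le> p \<le> n\<close>.\<close>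

definition koszul_d ::
    "('l::complex_lie_algebra \<Rightarrow> 'x::complex_banach \<Rightarrow> 'x) \<Rightarrow> nat \<Rightarrow> (nat set \<Rightarrow> 'x) \<Rightarrow> nat set \<Rightarrow> 'x" where
  "koszul_d \<rho> p u =
     (if 1 \<le> p \<and> p \<le> cdim TYPE('l)
      then (\<lambda>J. \<Sum>I\<in>indices TYPE('l) p. koszul_formula \<rho> (u I) (map lie_basis (sorted_list_of_set I)) J)
      else (\<lambda>_. 0))"

definition koszul_range ::
    "('l::complex_lie_algebra \<Rightarrow> 'x::complex_banach \<Rightarrow> 'x) \<Rightarrow> nat \<Rightarrow> (nat set \<Rightarrow> 'x) set" where
  "koszul_range \<rho> p = koszul_d \<rho> p ` koszul_space TYPE('l) p"

definition koszul_kernel ::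
    "('l::complex_lie_algebra \<Rightarrow> 'x::complex_banach \<Rightarrow> 'x) \<Rightarrow> nat \<Rightarrow> (nat set \<Rightarrow> 'x) set" where
  "koszul_kernel \<rho> p = {u \<in> koszul_space TYPE('l) p. koszul_d \<rho> p u = (\<lambda>_. 0)}"

text \<open>The quotient space, as the set of cosets; its zero is the coset \<open>koszul_range \<rho> (p + 1)\<close>.\<close>

definition koszul_homology ::
    "('l::complex_lie_algebra \<Rightarrow> 'x::complex_banach \<Rightarrow> 'x) \<Rightarrow> nat \<Rightarrow> (nat set \<Rightarrow> 'x) set set" where
  "koszul_homology \<rho> p = {{\<lambda>I. z I + b I | b. b \<in> koszul_range \<rho> (p + 1)} | z. z \<in> koszul_kernel \<rho> p}"

definition homology_nonzero ::
    "('l::complex_lie_algebra \<Rightarrow> 'x::complex_banach \<Rightarrow> 'x) \<Rightarrow> nat \<Rightarrow> bool" where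
  "homology_nonzero \<rho> p \<longleftrightarrow> koszul_homology \<rho> p \<noteq> {koszul_range \<rho> (p + 1)}"

section \<open>Joint spectra\<close>

definition shift ::
    "('l::complex_lie_algebra \<Rightarrow> 'x::complex_banach \<Rightarrow> 'x) \<Rightarrow> ('l \<Rightarrow> complex) \<Rightarrow> 'l \<Rightarrow> 'x \<Rightarrow> 'x" where
  "shift \<rho> f = (\<lambda>l x. \<rho> l x - f l *\<^sub>C x)"

definition sigma_p ::
    "nat \<Rightarrow> ('l::complex_lie_algebra \<Rightarrow> 'x::complex_banach \<Rightarrow> 'x) \<Rightarrow> ('l \<Rightarrow> complex) set" where
  "sigma_p p \<rho> = {f \<in> characters. homology_nonzero (shift \<rho> f) p}"

definition taylor_spectrum ::
    "('l::complex_lie_algebra \<Rightarrow> 'x::complex_banach \<Rightarrow> 'x) \<Rightarrow> ('l \<Rightarrow> complex) set" where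
  "taylor_spectrum \<rho> = (\<Union>p\<in>{0..cdim TYPE('l)}. sigma_p p \<rho>)"

definition slodkowski_delta ::
    "nat \<Rightarrow> ('l::complex_lie_algebra \<Rightarrow> 'x::complex_banach \<Rightarrow> 'x) \<Rightarrow> ('l \<Rightarrow> complex) set" where
  "slodkowski_delta k \<rho> = (\<Union>p\<in>{0..k}. sigma_p p \<rho>)"

text \<open>
  \<open>closed\<close> refers to the product topology on \<open>nat set \<Rightarrow> 'x\<close>. Every \<open>koszul_space\<close> is a closed
  subspace on which this topology is the one of the finite direct sum of copies of \<open>X\<close>.
\<close>

definition slodkowski_pi ::
    "nat \<Rightarrow> ('l::complex_lie_algebra \<Rightarrow> 'x::complex_banach \<Rightarrow> 'x) \<Rightarrow> ('l \<Rightarrow> complex) set" where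
  "slodkowski_pi k \<rho> =
     (\<Union>p\<in>{cdim TYPE('l) - k..cdim TYPE('l)}. sigma_p p \<rho>) \<union>
     {f \<in> characters. \<not> closed (koszul_range (shift \<rho> f) (cdim TYPE('l) - k))}"

end

theory Submission
  imports Defs "HOL-Library.Function_Algebras"
begin

text \<open>
  Replacing \<open>\<rho>\<close> by \<open>\<rho> - f\<close>, it suffices to treat the character \<open>0\<close>. Call \<open>x\<close> invariant if
  \<open>\<rho> l x = 0\<close> for all \<open>l\<close>. All spaces have finite dimension, so all ranges are closed
  (\<open>closed_koszul_range\<close>), and the theorem follows from three facts about the Koszul complex of a
  finite-dimensional module \<open>X\<close> over a nilpotent Lie algebra \<open>L\<close> of dimension \<open>n\<close>. If \<open>X\<close> contains no
  invariant vector except \<open>0\<close>, all homology vanishes. If it contains a nonzero one, the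
  homology in degree \<open>0\<close> and the homology in degree \<open>n\<close> are both nonzero. Every \<open>\<sigma>\<^bsub>\<delta>,k\<^esub>\<close> sees degree \<open>0\<close> and
  every \<open>\<sigma>\<^bsub>\<pi>,k\<^esub>\<close> sees degree \<open>n\<close>, so all the spectra coincide with the set of characters that have a
  common eigenvector.

  The structure of \<open>X\<close> enters through the Fitting decomposition of single operators
  (\<open>submodule_induct\<close>): since \<open>ad l\<close> is nilpotent, the Fitting summands of \<open>\<rho> l\<close> are submodules, so
  \<open>X\<close> is a direct sum of a submodule on which every \<open>\<rho> l\<close> is nilpotent and of submodules on each
  of which some \<open>\<rho> l\<close> is bijective. On the former, Engel's theorem and its dual apply
  (\<open>engel_invariant\<close>, \<open>engel_coinvariant\<close>).

  The homology is controlled by Cartan's formula (\<open>cartan_formula\<close>): exterior multiplication by \<open>l\<close> is a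
  homotopy from \<open>0\<close> to the natural action of \<open>l\<close> on \<open>X \<otimes> \<and>L\<close>, which is the sum of \<open>\<rho> l\<close> on the
  coefficients and of the derivation extending \<open>ad l\<close>. The derivation is nilpotent and commutes with the
  first summand. If \<open>\<rho> l\<close> is bijective, the action of \<open>l\<close> is therefore bijective and homotopic to \<open>0\<close>, so the
  complex is exact (\<open>acyclic_of_bijective\<close>). In top degree the nilpotent derivation acts on a line and hence
  vanishes, so an invariant vector is a cycle (\<open>koszul_top\<close>). In degree \<open>0\<close> the
  homology is \<open>X / \<rho>(L) X\<close>, which is nonzero as soon as the nilpotent summand is
  (\<open>coinvariants_zero_imp_invariants_zero\<close>).

  These computations use a description of the differential by creation and annihilation
  operators, which satisfy the canonical anticommutation relations; \<open>koszul_d_eq\<close> identifies it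
  with the one given by minors of coordinate matrices.
\<close>

section \<open>Linear algebra over the complex numbers\<close>

text \<open>
  Functions into a complex vector space form one. With this instance the spaces of Koszul chains are
  complex vector spaces in the sense of the type class, and the same linear algebra applies to
  \<open>X\<close>, to \<open>L\<close> and to chains.
\<close>

instantiation "fun" :: (type, complex_vector) complex_vector
begin

definition scaleC_fun :: "complex \<Rightarrow> ('a \<Rightarrow> 'b) \<Rightarrow> 'a \<Rightarrow> 'b" where
  "scaleC_fun a f = (\<lambda>x. a *\<^sub>C f x)"

instance
  by standard
    (simp_all add: scaleC_fun_def fun_eq_iff scaleC_add_right scaleC_add_left scaleC_scaleC scaleC_one)

end

lemma scaleC_fun_apply [simp]: "(a *\<^sub>C f) x = a *\<^sub>C f x"
  by (simp add: scaleC_fun_def)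

interpretation cpair: vector_space_pair
  "scaleC :: complex \<Rightarrow> 'a \<Rightarrow> 'a::complex_vector" "scaleC :: complex \<Rightarrow> 'b \<Rightarrow> 'b::complex_vector" ..

abbreviation clinear :: "('a::complex_vector \<Rightarrow> 'b::complex_vector) \<Rightarrow> bool" where
  "clinear \<equiv> Vector_Spaces.linear scaleC scaleC"

lemma clinearI:
  assumes "\<And>x y. T (x + y) = T x + T y" "\<And>a x. T (a *\<^sub>C x) = a *\<^sub>C T x"
  shows "clinear T"
  by (simp add: Vector_Spaces.linear_iff cvec.vector_space_axioms assms)

lemma clinear_funpow: "clinear T \<Longrightarrow> clinear (T ^^ k)" for T :: "'a::complex_vector \<Rightarrow> 'a"
  by (induction k) (auto intro!: clinearI simp: cpair.linear_add cpair.linear_scale)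

lemma finite_dimensional_basis:
  assumes "finite_dimensional TYPE('x::complex_vector)"
  obtains B :: "'x::complex_vector set" where "finite_dimensional_vector_space scaleC B"
proof -
  obtain A :: "'x set" where A: "finite A" "cvec.span A = UNIV"
    using assms by (auto simp: finite_dimensional_def)
  obtain B where B: "B \<subseteq> A" "cvec.independent B" "A \<subseteq> cvec.span B"
    using cvec.maximal_independent_subset[of A] by blast
  have "cvec.span B = UNIV"
    using B(3) A(2) by (metis cvec.span_mono cvec.span_span top.extremum_uniqueI)
  then have "finite_dimensional_vector_space scaleC B"
    using B A(1) by unfold_locales (auto intro: finite_subset)
  then show ?thesis using that by blast
qed

lemma dim_subset_finite_dimensional:
  fixes S T :: "'x::complex_vector set"
  assumes "finite_dimensional TYPE('x)" "S \<subseteq> T"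
  shows "cvec.dim S \<le> cvec.dim T"
proof -
  obtain B :: "'x set" where "finite_dimensional_vector_space scaleC B"
    using assms(1) by (rule finite_dimensional_basis)
  then interpret fd: finite_dimensional_vector_space scaleC B .
  show ?thesis by (rule fd.dim_subset[OF assms(2)])
qed

lemma subspace_dim_equal_finite_dimensional:
  fixes S T :: "'x::complex_vector set"
  assumes "finite_dimensional TYPE('x)" "cvec.subspace S" "cvec.subspace T" "S \<subseteq> T" "cvec.dim T \<le> cvec.dim S"
  shows "S = T"
proof -
  obtain B :: "'x set" where "finite_dimensional_vector_space scaleC B"
    using assms(1) by (rule finite_dimensional_basis)
  then interpret fd: finite_dimensional_vector_space scaleC B .
  show ?thesis using fd.subspace_dim_equal assms(2-) by blast
qed

text \<open>
  Fitting decomposition of \<open>V\<close> under \<open>T\<close>. The kernels of \<open>T ^^ k\<close> increase and the images of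
  \<open>T ^^ k\<close> decrease, so in finite dimension both sequences are constant from some exponent \<open>K\<close> on. The
  two summands are also described without \<open>K\<close>, because their invariance under other operators is
  proved one exponent at a time.
\<close>

lemma fitting_decomposition:
  fixes T :: "'x::complex_vector \<Rightarrow> 'x"
  assumes fd: "finite_dimensional TYPE('x)" and T: "clinear T"
    and V: "cvec.subspace V" "T ` V \<subseteq> V"
  obtains K where
    "{v \<in> V. (T ^^ K) v = 0} = {v \<in> V. \<exists>k. (T ^^ k) v = 0}"
    "(T ^^ K) ` V = (\<Inter>k. (T ^^ k) ` V)"
    "\<And>v. v \<in> V \<Longrightarrow> \<exists>a \<in> {v \<in> V. (T ^^ K) v = 0}. \<exists>b \<in> (T ^^ K) ` V. v = a + b"
    "{v \<in> V. (T ^^ K) v = 0} \<inter> (T ^^ K) ` V = {0}"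
    "inj_on T ((T ^^ K) ` V)" "T ` (T ^^ K) ` V = (T ^^ K) ` V"
proof -
  note Tk = clinear_funpow[OF T]
  define ker where "ker = (\<lambda>k. {v \<in> V. (T ^^ k) v = 0})"
  define im where "im = (\<lambda>k. (T ^^ k) ` V)"
  have ker_sub: "cvec.subspace (ker k)" for k
    using V(1) Tk[of k]
    by (auto simp: ker_def cvec.subspace_def cpair.linear_0 cpair.linear_add cpair.linear_scale)
  have im_sub: "cvec.subspace (im k)" for k
    unfolding im_def by (rule cpair.linear_subspace_image[OF Tk V(1)])
  have TV: "(T ^^ k) v \<in> V" if "v \<in> V" for v k
    using that V(2) by (induction k) auto
  have add: "(T ^^ (i + j)) v = (T ^^ i) ((T ^^ j) v)" for i j v
    by (simp add: funpow_add)
  have ker_mono: "ker i \<subseteq> ker j" if "i \<le> j" for i j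
  proof -
    have "(T ^^ j) v = (T ^^ (j - i)) ((T ^^ i) v)" for v
      using add[of "j - i" i v] that by simp
    then show ?thesis by (auto simp: ker_def cpair.linear_0[OF Tk])
  qed
  have im_mono: "im j \<subseteq> im i" if "i \<le> j" for i j
  proof -
    have "(T ^^ j) v = (T ^^ i) ((T ^^ (j - i)) v)" for v
      using add[of i "j - i" v] that by simp
    then show ?thesis by (auto simp: im_def TV)
  qed
  \<comment> \<open>An exponent with kernel of maximal dimension and one with image of minimal dimension.\<close>
  obtain M where M: "\<And>k. cvec.dim (ker k) \<le> cvec.dim (ker M)"
    using ex_has_greatest_nat[of "\<lambda>_. True" 0 "\<lambda>k. cvec.dim (ker k)" "Suc (cvec.dim (UNIV::'x set))"]
      dim_subset_finite_dimensional[OF fd, of _ UNIV] by (auto simp: less_Suc_eq_le)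
  obtain N where N: "\<And>k. cvec.dim (im N) \<le> cvec.dim (im k)"
    using ex_has_least_nat[of "\<lambda>_. True" 0 "\<lambda>k. cvec.dim (im k)"] by auto
  define K where "K = max M N"
  have kerK: "ker k \<subseteq> ker K" for k
  proof -
    have "ker M = ker (max k M)"
      by (rule subspace_dim_equal_finite_dimensional[OF fd ker_sub ker_sub ker_mono M]) simp
    then show ?thesis using ker_mono[of k "max k M"] ker_mono[of M K] by (simp add: K_def)
  qed
  have imK: "im K \<subseteq> im k" for k
  proof -
    have "im (max k N) = im N"
      by (rule subspace_dim_equal_finite_dimensional[OF fd im_sub im_sub im_mono N]) simp
    then show ?thesis using im_mono[of k "max k N"] im_mono[of N K] by (simp add: K_def)
  qed
  have int: "v = 0" if v: "v \<in> im K" "(T ^^ k) v = 0" for v k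
  proof -
    obtain w where w: "w \<in> V" "v = (T ^^ K) w" using v by (auto simp: im_def)
    then have "w \<in> ker (k + K)" using v by (simp add: ker_def add)
    then show ?thesis using kerK w by (auto simp: ker_def)
  qed
  show ?thesis
  proof (rule that[of K])
    show "{v \<in> V. (T ^^ K) v = 0} = {v \<in> V. \<exists>k. (T ^^ k) v = 0}"
      using kerK by (auto simp: ker_def)
    show "(T ^^ K) ` V = (\<Inter>k. (T ^^ k) ` V)"
      using imK by (auto simp: im_def)
    show "\<exists>a \<in> {v \<in> V. (T ^^ K) v = 0}. \<exists>b \<in> (T ^^ K) ` V. v = a + b" if v: "v \<in> V" for v
    proof -
      have "(T ^^ K) v \<in> im (K + K)" using imK v by (auto simp: im_def)
      then obtain w where w: "w \<in> V" "(T ^^ K) v = (T ^^ K) ((T ^^ K) w)"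
        by (auto simp: im_def add)
      show ?thesis
      proof (intro bexI)
        show "v = (v - (T ^^ K) w) + (T ^^ K) w" by simp
        show "(T ^^ K) w \<in> (T ^^ K) ` V" using w by simp
        show "v - (T ^^ K) w \<in> {v \<in> V. (T ^^ K) v = 0}"
          using w v V(1) TV by (auto simp: cvec.subspace_diff cpair.linear_diff[OF Tk])
      qed
    qed
    show "{v \<in> V. (T ^^ K) v = 0} \<inter> (T ^^ K) ` V = {0}"
      using int[of _ K] cvec.subspace_0[OF ker_sub[of K]] cvec.subspace_0[OF im_sub[of K]]
      by (auto simp: ker_def im_def)
    show "inj_on T ((T ^^ K) ` V)"
    proof (rule inj_onI)
      fix x y assume xy: "x \<in> (T ^^ K) ` V" "y \<in> (T ^^ K) ` V" "T x = T y"
      then have "x - y \<in> im K" using im_sub[of K] by (auto simp: im_def intro: cvec.subspace_diff)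
      moreover have "(T ^^ 1) (x - y) = 0" using xy T by (simp add: cpair.linear_diff)
      ultimately have "x - y = 0" by (rule int)
      then show "x = y" by simp
    qed
    have "T ` im K = im (Suc K)" by (auto simp: im_def)
    moreover have "im (Suc K) = im K" using imK[of "Suc K"] im_mono[of K "Suc K"] by auto
    ultimately show "T ` (T ^^ K) ` V = (T ^^ K) ` V" by (simp add: im_def)
  qed
qed

section \<open>Nilpotent Lie algebras\<close>

lemma bracket_0_left [simp]: "bracket 0 m = 0" and bracket_0_right [simp]: "bracket m 0 = 0"
  for m :: "'l::complex_lie_algebra"
  using bracket_scaleC_left[of 0 m m] bracket_scaleC_right[of m 0 m] by simp_all

lemma bracket_antisym: "bracket l m = - bracket m l" for l m :: "'l::complex_lie_algebra"
proof -
  have "bracket (l + m) (l + m) = bracket l m + bracket m l"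
    unfolding bracket_add_left bracket_add_right by (simp add: bracket_self)
  then show ?thesis by (simp add: bracket_self add_eq_0_iff)
qed

lemma clinear_bracket_right: "clinear (bracket l)" for l :: "'l::complex_lie_algebra"
  by (rule clinearI) (simp_all add: bracket_add_right bracket_scaleC_right)

lemma ad_nilpotent:
  fixes l :: "'l::complex_lie_algebra"
  assumes "nilpotent TYPE('l)"
  shows "\<exists>N. \<forall>m :: 'l. (bracket l ^^ N) m = 0"
proof -
  obtain N where N: "lower_central N = {0 :: 'l}" using assms by (auto simp: nilpotent_def)
  have "(bracket l ^^ i) m \<in> lower_central i" for i and m :: 'l
    by (induction i) (auto intro!: cvec.span_base)
  then show ?thesis using N by blast
qed

lemma subspace_lower_central: "cvec.subspace (lower_central i :: 'l::complex_lie_algebra set)"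
  by (cases i) (simp_all add: cvec.subspace_UNIV cvec.subspace_span)

lemma lower_central_antimono: "lower_central (Suc i) \<subseteq> (lower_central i :: 'l::complex_lie_algebra set)"
proof (induction i)
  case (Suc i)
  show ?case unfolding lower_central.simps(2)[of "Suc i"] lower_central.simps(2)[of i]
    by (rule cvec.span_mono) (use Suc in auto)
qed simp

lemma span_insert_span: "cvec.span (insert m (cvec.span S)) = cvec.span (insert m S)"
  for m :: "'a::complex_vector"
proof
  have "cvec.span S \<subseteq> cvec.span (insert m S)" by (rule cvec.span_mono) auto
  then show "cvec.span (insert m (cvec.span S)) \<subseteq> cvec.span (insert m S)"
    by (intro cvec.span_minimal) (auto intro: cvec.span_base)
  show "cvec.span (insert m S) \<subseteq> cvec.span (insert m (cvec.span S))"
    by (rule cvec.span_mono) (auto intro: cvec.span_base)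
qed

text \<open>
  A nilpotent Lie algebra is built up from \<open>0\<close> by adjoining one vector \<open>m\<close> at a time whose brackets
  already lie in the part \<open>I\<close> constructed so far: climb the lower central series from its last term,
  adjoining a basis of each term to the next one. This is how Engel's theorem is reduced to a single
  nilpotent operator.
\<close>

lemma nilpotent_induct [consumes 2, case_names zero step]:
  fixes P :: "'l::complex_lie_algebra set \<Rightarrow> bool"
  assumes fd: "finite_dimensional TYPE('l)" and nil: "nilpotent TYPE('l)"
    and zero: "P {0}"
    and step: "\<And>I m. cvec.subspace I \<Longrightarrow> (\<And>l. bracket l m \<in> I) \<Longrightarrow> P I \<Longrightarrow> P (cvec.span (insert m I))"
  shows "P UNIV"
proof -
  obtain N where N: "lower_central N = {0 :: 'l}" using nil by (auto simp: nilpotent_def)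
  have "P (lower_central (N - k))" if "k \<le> N" for k
    using that
  proof (induction k)
    case 0
    then show ?case by (simp add: N zero)
  next
    case (Suc k)
    define i where "i = N - Suc k"
    have i: "N - k = Suc i" using Suc.prems by (simp add: i_def)
    obtain B :: "'l set" where "finite_dimensional_vector_space scaleC B"
      using fd by (rule finite_dimensional_basis)
    then interpret fdl: finite_dimensional_vector_space scaleC B .
    obtain A :: "'l set" where A: "A \<subseteq> lower_central i" "cvec.independent A" "lower_central i \<subseteq> cvec.span A"
      using cvec.maximal_independent_subset[of "lower_central i :: 'l set"] by blast
    have "finite A" using A(2) by (rule fdl.finiteI_independent)
    moreover have "P (cvec.span (A' \<union> lower_central (Suc i)))" if "finite A'" "A' \<subseteq> A" for A'
      using that
    proof (induction A')
      case empty
      have eq: "cvec.span (lower_central (Suc i)) = (lower_central (Suc i) :: 'l set)"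
        by (subst cvec.span_eq_iff) (rule subspace_lower_central)
      have "P (lower_central (Suc i))" using Suc.IH Suc.prems i by (simp del: lower_central.simps)
      then show ?case unfolding Un_empty_left eq .
    next
      case (insert m A')
      have "bracket l m \<in> lower_central (Suc i)" for l
        using insert.prems A by (auto intro!: cvec.span_base)
      then have "P (cvec.span (insert m (cvec.span (A' \<union> lower_central (Suc i)))))"
        using insert by (intro step) (auto intro: cvec.span_base simp del: lower_central.simps)
      then show ?case by (simp add: span_insert_span del: lower_central.simps)
    qed
    ultimately have "P (cvec.span (A \<union> lower_central (Suc i)))" by blast
    also have "cvec.span (A \<union> lower_central (Suc i)) = lower_central i"
    proof
      show "cvec.span (A \<union> lower_central (Suc i)) \<subseteq> lower_central i"
        using A(1) lower_central_antimono by (intro cvec.span_minimal subspace_lower_central) auto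
      show "lower_central i \<subseteq> cvec.span (A \<union> lower_central (Suc i))"
        using A(3) cvec.span_mono[of A "A \<union> lower_central (Suc i)"] by auto
    qed
    finally show ?case by (simp add: i_def)
  qed
  from this[of N] show ?thesis by simp
qed

text \<open>
  If \<open>T\<close> satisfies a Leibniz rule over \<open>ad l\<close> with respect to an action \<open>\<beta>\<close>, then \<open>T ^^ (j + k)\<close> applied
  to \<open>\<beta> m v\<close> is a sum of terms \<open>\<beta> ((ad l) ^^ i m) ((T ^^ i') v)\<close> with \<open>i + i' = j + k\<close>, and each of them
  has \<open>i \<ge> j\<close> or \<open>i' \<ge> k\<close>. It is used twice: with \<open>\<beta>\<close> the given representation, and with \<open>\<beta>\<close> the
  exterior multiplication.
\<close>

lemma leibniz_nilpotent:
  fixes T :: "'c::complex_vector \<Rightarrow> 'c" and \<beta> :: "'l::complex_lie_algebra \<Rightarrow> 'c \<Rightarrow> 'c"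
  assumes T: "clinear T" and \<beta>0: "\<And>v. \<beta> 0 v = 0" "\<And>m. \<beta> m 0 = 0"
    and leibniz: "\<And>m v. T (\<beta> m v) = \<beta> (bracket l m) v + \<beta> m (T v)"
    and "(bracket l ^^ j) m = 0" "(T ^^ k) v = 0"
  shows "(T ^^ (j + k)) (\<beta> m v) = 0"
  using assms(5,6)
proof (induction "j + k" arbitrary: j k m v)
  case 0
  then show ?case by (simp add: \<beta>0)
next
  case (Suc s)
  note T0 = cpair.linear_0[OF clinear_funpow[OF T]]
  show ?case
  proof (cases "j = 0 \<or> k = 0")
    case True
    then show ?thesis using Suc.prems by (auto simp: \<beta>0 T0)
  next
    case False
    then obtain j' k' where jk: "j = Suc j'" "k = Suc k'" by (cases j; cases k) auto
    have "(T ^^ (j' + k)) (\<beta> (bracket l m) v) = 0"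
      using Suc.prems Suc.hyps(2) jk
      by (intro Suc.hyps(1)) (auto simp: funpow_Suc_right simp del: funpow.simps)
    moreover have "(T ^^ (j + k')) (\<beta> m (T v)) = 0"
      using Suc.prems Suc.hyps(2) jk
      by (intro Suc.hyps(1)) (auto simp: funpow_Suc_right simp del: funpow.simps)
    moreover have "(T ^^ (j + k)) (\<beta> m v) = (T ^^ (j' + k)) (T (\<beta> m v))"
      by (simp add: jk(1) funpow_Suc_right del: funpow.simps)
    ultimately show ?thesis
      by (simp add: leibniz cpair.linear_add[OF clinear_funpow[OF T]] jk del: funpow.simps)
  qed
qed

section \<open>Modules over a nilpotent Lie algebra\<close>

locale lie_module =
  fixes \<rho> :: "'l::complex_lie_algebra \<Rightarrow> 'x::complex_vector \<Rightarrow> 'x"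
  assumes linear_right: "clinear (\<rho> l)"
    and linear_left: "clinear (\<lambda>l. \<rho> l x)"
    and action_bracket: "\<rho> (bracket l m) x = \<rho> l (\<rho> m x) - \<rho> m (\<rho> l x)"
begin

lemmas action_simps =
  cpair.linear_0[OF linear_right] cpair.linear_add[OF linear_right] cpair.linear_scale[OF linear_right]
  cpair.linear_diff[OF linear_right] cpair.linear_0[OF linear_left] cpair.linear_add[OF linear_left]
  cpair.linear_scale[OF linear_left]

definition submodule :: "'x set \<Rightarrow> bool" where
  "submodule V \<longleftrightarrow> cvec.subspace V \<and> (\<forall>l. \<forall>v \<in> V. \<rho> l v \<in> V)"

lemma submodule_UNIV: "submodule UNIV"
  by (simp add: submodule_def cvec.subspace_UNIV)

lemma submodule_funpow: "submodule V \<Longrightarrow> v \<in> V \<Longrightarrow> (\<rho> l ^^ k) v \<in> V"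
  by (induction k) (auto simp: submodule_def)

lemma action_leibniz: "\<rho> l (\<rho> m v) = \<rho> (bracket l m) v + \<rho> m (\<rho> l v)"
  by (simp add: action_bracket)

text \<open>
  The counterpart of the Leibniz argument for images: rewriting
  \<open>\<rho> m (\<rho> l w) = \<rho> l (\<rho> m w) - \<rho> [l, m] w\<close> repeatedly, either \<open>k\<close> factors \<open>\<rho> l\<close> come out on the left, or
  \<open>m\<close> is replaced by \<open>(ad l) ^^ j m = 0\<close>.
\<close>

lemma action_image_power:
  assumes V: "submodule V"
  shows "(bracket l ^^ j) m = 0 \<Longrightarrow> v \<in> V \<Longrightarrow> \<rho> m ((\<rho> l ^^ (j + k)) v) \<in> (\<rho> l ^^ k) ` V"
proof (induction "j + k" arbitrary: j k m v)
  case 0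
  then show ?case using V by (simp add: submodule_def)
next
  case (Suc s)
  have sub: "cvec.subspace ((\<rho> l ^^ k) ` V)"
    using V by (intro cpair.linear_subspace_image clinear_funpow linear_right) (simp add: submodule_def)
  consider "j = 0" | "k = 0" | j' k' where "j = Suc j'" "k = Suc k'"
    by (cases j; cases k) auto
  then show ?case
  proof cases
    case 1
    then show ?thesis using Suc.prems sub cvec.subspace_0 by (simp add: action_simps)
  next
    case 2
    then show ?thesis using V submodule_funpow[OF V Suc.prems(2)] by (simp add: submodule_def)
  next
    case 3
    define w where "w = (\<rho> l ^^ (j + k')) v"
    have "\<rho> m w \<in> (\<rho> l ^^ k') ` V"
      unfolding w_def using Suc.prems Suc.hyps(2) 3 by (intro Suc.hyps(1)) auto
    then have 1: "\<rho> l (\<rho> m w) \<in> (\<rho> l ^^ k) ` V"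
      by (auto simp: 3)
    have "\<rho> (bracket l m) ((\<rho> l ^^ (j' + k)) v) \<in> (\<rho> l ^^ k) ` V"
      using Suc.prems Suc.hyps(2) 3
      by (intro Suc.hyps(1)) (auto simp: funpow_Suc_right simp del: funpow.simps)
    then have 2: "\<rho> (bracket l m) w \<in> (\<rho> l ^^ k) ` V" by (simp add: w_def 3)
    have "\<rho> m ((\<rho> l ^^ (j + k)) v) = \<rho> m (\<rho> l w)" by (simp add: w_def 3)
    also have "\<dots> = \<rho> l (\<rho> m w) - \<rho> (bracket l m) w" by (simp add: action_bracket)
    finally show ?thesis using cvec.subspace_diff[OF sub 1 2] by simp
  qed
qed

text \<open>
  Both Fitting summands of a single \<open>\<rho> l\<close> are invariant under the whole Lie algebra, because
  \<open>ad l\<close> is nilpotent.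
\<close>

lemma submodule_fitting_null:
  assumes "nilpotent TYPE('l)" "submodule V"
  shows "submodule {v \<in> V. \<exists>k. (\<rho> l ^^ k) v = 0}"
proof -
  note lin = clinear_funpow[OF linear_right]
  obtain N where N: "\<And>m. (bracket l ^^ N) m = 0" using ad_nilpotent[OF assms(1)] by blast
  have more: "(\<rho> l ^^ (j + k)) v = 0" "(\<rho> l ^^ (k + j)) v = 0" if "(\<rho> l ^^ k) v = 0" for j k v
    using that funpow_add[of j k "\<rho> l"] by (simp_all add: cpair.linear_0[OF lin] add.commute)
  have "\<exists>k. (\<rho> l ^^ k) (v + w) = 0" if "(\<rho> l ^^ i) v = 0" "(\<rho> l ^^ j) w = 0" for v w i j
    using more[OF that(1)] more[OF that(2)] by (intro exI[of _ "i + j"]) (simp add: cpair.linear_add[OF lin])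
  moreover have "\<exists>k. (\<rho> l ^^ k) (\<rho> m v) = 0" if "(\<rho> l ^^ k) v = 0" for k m v
    using leibniz_nilpotent[where T = "\<rho> l" and \<beta> = \<rho>, OF linear_right _ _ action_leibniz N that]
    by (auto simp: action_simps)
  moreover have "\<exists>k. (\<rho> l ^^ k) 0 = 0" by (auto intro: exI[of _ 0])
  ultimately show ?thesis
    using assms(2) by (auto simp: submodule_def cvec.subspace_def cpair.linear_scale[OF lin])
qed

lemma submodule_fitting_one:
  assumes "nilpotent TYPE('l)" "submodule V"
  shows "submodule (\<Inter>k. (\<rho> l ^^ k) ` V)"
  unfolding submodule_def
proof (intro conjI allI ballI)
  show "cvec.subspace (\<Inter>k. (\<rho> l ^^ k) ` V)"
    using assms(2)
    by (auto simp: submodule_def intro!: cvec.subspace_Inter cpair.linear_subspace_image clinear_funpow linear_right)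
  obtain N where N: "\<And>m. (bracket l ^^ N) m = 0" using ad_nilpotent[OF assms(1)] by blast
  fix m w assume w: "w \<in> (\<Inter>k. (\<rho> l ^^ k) ` V)"
  show "\<rho> m w \<in> (\<Inter>k. (\<rho> l ^^ k) ` V)"
  proof
    fix k
    obtain v where "v \<in> V" "w = (\<rho> l ^^ (N + k)) v" using w by blast
    then show "\<rho> m w \<in> (\<rho> l ^^ k) ` V" using action_image_power[OF assms(2) N] by blast
  qed
qed

text \<open>
  The replacement for a full weight space decomposition. Either every \<open>\<rho> l\<close> is nilpotent on \<open>V\<close>, or
  some \<open>\<rho> l\<close> is not, and then its Fitting decomposition splits off a nonzero submodule on which
  \<open>\<rho> l\<close> is bijective, leaving a smaller submodule. Hence a property of submodules only has to be
  checked in the nilpotent case and to be stable under adding such a complement.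
\<close>

lemma submodule_induct [consumes 3, case_names nil split]:
  assumes fd: "finite_dimensional TYPE('x)" and nl: "nilpotent TYPE('l)" and V: "submodule V"
    and nil: "\<And>V. submodule V \<Longrightarrow> (\<And>l. \<exists>K. \<forall>v \<in> V. (\<rho> l ^^ K) v = 0) \<Longrightarrow> P V"
    and split: "\<And>V V0 V1 l. submodule V0 \<Longrightarrow> submodule V1 \<Longrightarrow> V0 \<inter> V1 = {0} \<Longrightarrow>
      V = {a + b | a b. a \<in> V0 \<and> b \<in> V1} \<Longrightarrow> inj_on (\<rho> l) V1 \<Longrightarrow> \<rho> l ` V1 = V1 \<Longrightarrow> P V0 \<Longrightarrow> P V"
  shows "P V"
  using V
proof (induction "cvec.dim V" arbitrary: V rule: less_induct)
  case less
  show ?case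
  proof (cases "\<forall>l. \<exists>K. \<forall>v \<in> V. (\<rho> l ^^ K) v = 0")
    case True
    then show ?thesis using nil less.prems by blast
  next
    case False
    then obtain l where l: "\<And>K. \<exists>v \<in> V. (\<rho> l ^^ K) v \<noteq> 0" by blast
    have V: "cvec.subspace V" "\<rho> l ` V \<subseteq> V" using less.prems by (auto simp: submodule_def)
    obtain K where K:
      "{v \<in> V. (\<rho> l ^^ K) v = 0} = {v \<in> V. \<exists>k. (\<rho> l ^^ k) v = 0}"
      "(\<rho> l ^^ K) ` V = (\<Inter>k. (\<rho> l ^^ k) ` V)"
      "\<And>v. v \<in> V \<Longrightarrow> \<exists>a \<in> {v \<in> V. (\<rho> l ^^ K) v = 0}. \<exists>b \<in> (\<rho> l ^^ K) ` V. v = a + b"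
      "{v \<in> V. (\<rho> l ^^ K) v = 0} \<inter> (\<rho> l ^^ K) ` V = {0}"
      "inj_on (\<rho> l) ((\<rho> l ^^ K) ` V)" "\<rho> l ` (\<rho> l ^^ K) ` V = (\<rho> l ^^ K) ` V"
      using fitting_decomposition[OF fd linear_right V] by blast
    define V0 where "V0 = {v \<in> V. (\<rho> l ^^ K) v = 0}"
    define V1 where "V1 = (\<rho> l ^^ K) ` V"
    have sub: "submodule V0" "submodule V1"
      unfolding V0_def V1_def K(1) K(2)
      by (intro submodule_fitting_null submodule_fitting_one nl less.prems)+
    have "V0 \<subset> V" using l[of K] by (auto simp: V0_def)
    then have "cvec.dim V0 < cvec.dim V"
      using subspace_dim_equal_finite_dimensional[OF fd, of V0 V] sub V
      by (force simp: submodule_def)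
    then have "P V0" using less.hyps sub by blast
    moreover have "V = {a + b | a b. a \<in> V0 \<and> b \<in> V1}"
    proof
      show "V \<subseteq> {a + b | a b. a \<in> V0 \<and> b \<in> V1}" using K(3) by (fastforce simp: V0_def V1_def)
      show "{a + b | a b. a \<in> V0 \<and> b \<in> V1} \<subseteq> V"
        using V submodule_funpow[OF less.prems] by (auto simp: V0_def V1_def intro!: cvec.subspace_add)
    qed
    ultimately show ?thesis
      using split[OF sub, of V l] K(4-6) unfolding V0_def[symmetric] V1_def[symmetric] by blast
  qed
qed

text \<open>
  Engel's theorem. The vectors of \<open>V\<close> killed by \<open>I\<close> are stable under \<open>\<rho> m\<close> when \<open>[L, m] \<subseteq> I\<close>, and
  a nilpotent operator has a nonzero kernel on every nonzero stable subspace.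
\<close>

lemma engel_invariant:
  assumes "finite_dimensional TYPE('l)" "nilpotent TYPE('l)" and V: "submodule V" "V \<noteq> {0}"
    and nil: "\<And>l. \<exists>K. \<forall>v \<in> V. (\<rho> l ^^ K) v = 0"
  shows "\<exists>x \<in> V. x \<noteq> 0 \<and> (\<forall>l. \<rho> l x = 0)"
proof -
  have "\<exists>x \<in> V. x \<noteq> 0 \<and> (\<forall>l \<in> UNIV. \<rho> l x = 0)"
    using assms(1,2)
  proof (induction rule: nilpotent_induct)
    case zero
    have "0 \<in> V" using V(1) by (simp add: submodule_def cvec.subspace_0)
    then show ?case using V(2) by (auto simp: action_simps)
  next
    case (step I m)
    then obtain x where x: "x \<in> V" "x \<noteq> 0" "\<And>l. l \<in> I \<Longrightarrow> \<rho> l x = 0" by blast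
    define y where "y = (\<lambda>k. (\<rho> m ^^ k) x)"
    have y: "y k \<in> V" "\<forall>l \<in> I. \<rho> l (y k) = 0" for k
    proof -
      show "y k \<in> V" using submodule_funpow[OF V(1) x(1)] by (simp add: y_def)
      have "\<forall>l \<in> I. \<rho> l (y k) = 0"
      proof (induction k)
        case 0
        then show ?case using x by (simp add: y_def)
      next
        case (Suc k)
        have "\<rho> l (y (Suc k)) = 0" if "l \<in> I" for l
        proof -
          have "\<rho> l (y (Suc k)) = \<rho> (bracket l m) (y k) + \<rho> m (\<rho> l (y k))"
            using action_leibniz[of l m "y k"] by (simp add: y_def)
          then show ?thesis using Suc that step(2) by (simp add: action_simps)
        qed
        then show ?case by blast
      qed
      then show "\<forall>l \<in> I. \<rho> l (y k) = 0" .
    qed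
    obtain K where "y K = 0" using nil x(1) by (auto simp: y_def)
    \<comment> \<open>The last nonzero vector among the \<open>(\<rho> m ^^ k) x\<close>.\<close>
    define k where "k = (LEAST k. y k = 0)"
    have "y k = 0" unfolding k_def by (rule LeastI) fact
    moreover have "y 0 \<noteq> 0" using x by (simp add: y_def)
    ultimately obtain k' where k': "k = Suc k'" by (cases k) auto
    then have nz: "y k' \<noteq> 0" using not_less_Least[of k' "\<lambda>k. y k = 0"] by (simp add: k_def)
    have "\<rho> m (y k') = 0" using \<open>y k = 0\<close> k' by (simp add: y_def)
    then have "insert m I \<subseteq> {l. \<rho> l (y k') = 0}" using y by auto
    moreover have "cvec.subspace {l. \<rho> l (y k') = 0}"
      by (auto simp: cvec.subspace_def action_simps)
    ultimately have "cvec.span (insert m I) \<subseteq> {l. \<rho> l (y k') = 0}" by (rule cvec.span_minimal)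
    then show ?case using y nz by blast
  qed
  then show ?thesis by simp
qed

text \<open>
  The dual form of Engel's theorem. If \<open>V = \<rho> m V + R\<close> with \<open>R\<close> stable under \<open>\<rho> m\<close>, then iteration gives
  \<open>V = (\<rho> m ^^ k) V + R\<close> for all \<open>k\<close>, so \<open>V = R\<close> by nilpotency; thus one basis vector of the Lie
  algebra after the other can be discarded until \<open>R = 0\<close>.
\<close>

lemma engel_coinvariant:
  assumes "finite_dimensional TYPE('l)" "nilpotent TYPE('l)" and V: "submodule V"
    and nil: "\<And>l. \<exists>K. \<forall>v \<in> V. (\<rho> l ^^ K) v = 0"
    and gen: "V \<subseteq> cvec.span {\<rho> l v | l v. v \<in> V}"
  shows "V = {0}"
proof -
  have "V \<subseteq> cvec.span {\<rho> l v | l v. l \<in> UNIV \<and> v \<in> V} \<longrightarrow> V = {0}"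
    using assms(1,2)
  proof (induction rule: nilpotent_induct)
    case zero
    have "cvec.span {\<rho> l v | l v. l \<in> {0} \<and> v \<in> V} \<subseteq> {0}"
      by (rule cvec.span_minimal) (auto simp: action_simps)
    moreover have "0 \<in> V" using V by (simp add: submodule_def cvec.subspace_0)
    ultimately show ?case by blast
  next
    case (step I m)
    show ?case
    proof
      assume gen: "V \<subseteq> cvec.span {\<rho> l v | l v. l \<in> cvec.span (insert m I) \<and> v \<in> V}"
      \<comment> \<open>The part of \<open>\<rho>(L) V\<close> that remains when \<open>m\<close> is discarded.\<close>
      define R where "R = cvec.span {\<rho> l v | l v. l \<in> I \<and> v \<in> V}"
      have R: "cvec.subspace R" by (simp add: R_def cvec.subspace_span)
      have base: "\<rho> l v \<in> R" if "l \<in> I" "v \<in> V" for l v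
        unfolding R_def using that by (intro cvec.span_base) auto
      have mV: "\<rho> m v \<in> V" if "v \<in> V" for v using V that by (simp add: submodule_def)
      have mR: "\<rho> m r \<in> R" if "r \<in> R" for r
      proof -
        have "R \<subseteq> \<rho> m -` R" unfolding R_def
        proof (rule cvec.span_minimal)
          show "cvec.subspace (\<rho> m -` cvec.span {\<rho> l v |l v. l \<in> I \<and> v \<in> V})"
            by (rule cpair.linear_subspace_vimage[OF linear_right cvec.subspace_span])
          show "{\<rho> l v |l v. l \<in> I \<and> v \<in> V} \<subseteq> \<rho> m -` cvec.span {\<rho> l v |l v. l \<in> I \<and> v \<in> V}"
          proof clarsimp
            fix l v assume lv: "l \<in> I" "v \<in> V"
            have "bracket m l \<in> I"
              using step(1,2) by (subst bracket_antisym) (auto intro: cvec.subspace_neg)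
            then have "\<rho> (bracket m l) v + \<rho> l (\<rho> m v) \<in> R"
              using R base mV lv by (auto intro: cvec.subspace_add)
            then show "\<rho> m (\<rho> l v) \<in> cvec.span {\<rho> l v |l v. l \<in> I \<and> v \<in> V}"
              by (simp add: action_leibniz[of m l v] R_def)
          qed
        qed
        then show ?thesis using that by blast
      qed
      have decomp: "\<exists>w \<in> V. \<exists>r \<in> R. v = \<rho> m w + r" if "v \<in> V" for v
      proof -
        define S where "S = {a + b | a b. a \<in> \<rho> m ` V \<and> b \<in> R}"
        have S: "cvec.subspace S"
          unfolding S_def using R V
          by (intro cvec.subspace_sums cpair.linear_subspace_image[OF linear_right])
             (auto simp: submodule_def)
        have S1: "\<rho> m v \<in> S" if "v \<in> V" for v
          unfolding S_def using cvec.subspace_0[OF R] that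
          by (intro CollectI exI[of _ "\<rho> m v"] exI[of _ 0]) auto
        have "0 \<in> \<rho> m ` V" using V cvec.subspace_0 by (force simp: submodule_def action_simps)
        then have S2: "\<rho> l v \<in> S" if "l \<in> I" "v \<in> V" for l v
          unfolding S_def using base[OF that] by (intro CollectI exI[of _ 0] exI[of _ "\<rho> l v"]) auto
        have "\<rho> l v \<in> S" if "v \<in> V" "l \<in> cvec.span (insert m I)" for l v
        proof -
          have "cvec.span (insert m I) \<subseteq> {l. \<rho> l v \<in> S}"
            using S1 S2 that S by (intro cvec.span_minimal) (auto simp: cvec.subspace_def action_simps)
          then show ?thesis using that by blast
        qed
        then have "cvec.span {\<rho> l v | l v. l \<in> cvec.span (insert m I) \<and> v \<in> V} \<subseteq> S"
          using S by (intro cvec.span_minimal) auto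
        then have "v \<in> S" using gen that by blast
        then show ?thesis by (auto simp: S_def)
      qed
      have iter: "\<exists>w \<in> V. \<exists>r \<in> R. v = (\<rho> m ^^ k) w + r" if "v \<in> V" for v k
      proof (induction k)
        case 0
        then show ?case using that cvec.subspace_0[OF R] by (intro bexI[of _ v] bexI[of _ 0]) auto
      next
        case (Suc k)
        then obtain w r where w: "w \<in> V" "r \<in> R" "v = (\<rho> m ^^ k) w + r" by blast
        obtain w' r' where w': "w' \<in> V" "r' \<in> R" "w = \<rho> m w' + r'" using decomp w by blast
        have "(\<rho> m ^^ k) r' \<in> R" using w'(2) mR by (induction k) auto
        moreover have "v = (\<rho> m ^^ Suc k) w' + ((\<rho> m ^^ k) r' + r)"
          using w(3) w'(3)
          by (simp add: cpair.linear_add[OF clinear_funpow[OF linear_right]] funpow_Suc_right add.assoc del: funpow.simps)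
        ultimately show ?case using w w' R by (blast intro: cvec.subspace_add)
      qed
      obtain K where "\<forall>v \<in> V. (\<rho> m ^^ K) v = 0" using nil by blast
      then have "V \<subseteq> R" using iter[of _ K] by fastforce
      then show "V = {0}" using step(3) by (simp add: R_def)
    qed
  qed
  then show ?thesis using gen by simp
qed

text \<open>
  The link between the two ends of the Koszul complex. A complement on which some \<open>\<rho> l\<close> is bijective
  contains no invariant vector and contributes nothing to \<open>V / \<rho>(L) V\<close>, so the
  statement reduces to modules on which the whole Lie algebra acts nilpotently.
\<close>

lemma coinvariants_zero_imp_invariants_zero:
  assumes "finite_dimensional TYPE('x)" "finite_dimensional TYPE('l)" "nilpotent TYPE('l)" "submodule V"
    and "V \<subseteq> cvec.span {\<rho> l v | l v. v \<in> V}"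
    and "x \<in> V" "\<And>l. \<rho> l x = 0"
  shows "x = 0"
proof -
  have "V \<subseteq> cvec.span {\<rho> l v | l v. v \<in> V} \<longrightarrow> (\<forall>x \<in> V. (\<forall>l. \<rho> l x = 0) \<longrightarrow> x = 0)"
    using assms(1,3,4)
  proof (induction rule: submodule_induct)
    case (nil V)
    then show ?case using engel_coinvariant[OF assms(2,3)] by blast
  next
    case (split V V0 V1 l)
    show ?case
    proof (intro impI ballI)
      assume gen: "V \<subseteq> cvec.span {\<rho> l v |l v. v \<in> V}"
      fix x assume x: "x \<in> V" "\<forall>l. \<rho> l x = 0"
      have sub: "cvec.subspace V0" "cvec.subspace V1"
        and inv: "\<And>l v. v \<in> V0 \<Longrightarrow> \<rho> l v \<in> V0" "\<And>l v. v \<in> V1 \<Longrightarrow> \<rho> l v \<in> V1"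
        using split(1,2) by (auto simp: submodule_def)
      define D where "D = cvec.span {\<rho> l v |l v. v \<in> V0}"
      have D: "D \<subseteq> V0" unfolding D_def using sub inv by (intro cvec.span_minimal) auto
      have "cvec.span {\<rho> l v |l v. v \<in> V} \<subseteq> {a + b | a b. a \<in> D \<and> b \<in> V1}"
      proof (rule cvec.span_minimal)
        show "cvec.subspace {a + b | a b. a \<in> D \<and> b \<in> V1}"
          unfolding D_def by (intro cvec.subspace_sums cvec.subspace_span sub)
        show "{\<rho> l v |l v. v \<in> V} \<subseteq> {a + b | a b. a \<in> D \<and> b \<in> V1}"
        proof clarsimp
          fix l v assume "v \<in> V"
          then obtain a b where ab: "a \<in> V0" "b \<in> V1" "v = a + b" using split(4) by blast
          have "\<rho> l a \<in> D" unfolding D_def using ab by (intro cvec.span_base) auto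
          then show "\<exists>a b. \<rho> l v = a + b \<and> a \<in> D \<and> b \<in> V1"
            using ab inv by (intro exI[of _ "\<rho> l a"] exI[of _ "\<rho> l b"]) (simp add: action_simps)
        qed
      qed
      then have VD: "V \<subseteq> {a + b | a b. a \<in> D \<and> b \<in> V1}" using gen by blast
      have direct: "b = 0" if "a + b = c" "a \<in> V0" "c \<in> V0" "b \<in> V1" for a b c
      proof -
        have "b = c - a" using that by (simp add: algebra_simps)
        then have "b \<in> V0" using that sub by (simp add: cvec.subspace_diff)
        then show ?thesis using that split(3) by blast
      qed
      have "V0 \<subseteq> D"
      proof
        fix v assume v: "v \<in> V0"
        then have "v \<in> V" using split(4) cvec.subspace_0[OF sub(2)] by force
        then obtain a b where ab: "a \<in> D" "b \<in> V1" "v = a + b" using VD by blast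
        then have "b = 0" using direct[of a b v] v D by auto
        then show "v \<in> D" using ab by simp
      qed
      then have V0: "\<forall>x \<in> V0. (\<forall>l. \<rho> l x = 0) \<longrightarrow> x = 0" using split(7) by (simp add: D_def)
      obtain a b where ab: "a \<in> V0" "b \<in> V1" "x = a + b" using x split(4) by blast
      have "\<rho> l b = 0" using direct[of "\<rho> l a" "\<rho> l b" 0] ab x inv sub
        by (metis action_simps(2) cvec.subspace_0)
      then have "b = 0" using split(5) ab(2) cvec.subspace_0[OF sub(2)]
        by (metis action_simps(1) inj_onD)
      then show "x = 0" using V0 ab x by simp
    qed
  qed
  then show ?thesis using assms by blast
qed

end

section \<open>Creation and annihilation operators\<close>

text \<open>
  The sign that arises when \<open>e i\<close> is moved to its place inside \<open>e I\<close>. With it, \<open>creation i\<close> is exterior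
  multiplication by \<open>e i\<close> from the left, and \<open>annihilation i\<close> is contraction with the
  dual basis vector. Only the finitely many elements below \<open>i\<close> enter the sign, so that the
  anticommutation relations hold for arbitrary functions on \<open>nat set\<close>.
\<close>

definition wsign :: "nat \<Rightarrow> nat set \<Rightarrow> complex" where
  "wsign i I = (-1) ^ card {j \<in> I. j < i}"

definition creation :: "nat \<Rightarrow> (nat set \<Rightarrow> 'x::complex_vector) \<Rightarrow> nat set \<Rightarrow> 'x" where
  "creation i u = (\<lambda>I. if i \<in> I then wsign i I *\<^sub>C u (I - {i}) else 0)"

definition annihilation :: "nat \<Rightarrow> (nat set \<Rightarrow> 'x::complex_vector) \<Rightarrow> nat set \<Rightarrow> 'x" where
  "annihilation i u = (\<lambda>I. if i \<in> I then 0 else wsign i I *\<^sub>C u (insert i I))"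

lemma wsign_insert: "wsign j (insert i I) = (if i \<notin> I \<and> i < j then - wsign j I else wsign j I)"
proof -
  have "{k \<in> insert i I. k < j} = (if i < j then insert i {k \<in> I. k < j} else {k \<in> I. k < j})" by auto
  then show ?thesis by (auto simp: wsign_def insert_absorb)
qed

lemma wsign_remove: "wsign j (I - {i}) = (if i \<in> I \<and> i < j then - wsign j I else wsign j I)"
  using wsign_insert[of j i "I - {i}"] by (cases "i \<in> I") (auto simp: insert_absorb)

lemma wsign_square [simp]: "wsign i I * wsign i I = 1"
  by (simp add: wsign_def flip: power_add)

text \<open>
  This and the next lemma are the anticommutation relations on which the computations with the
  differential rest: inserting or removing an index below \<open>j\<close> changes the sign that belongs to \<open>j\<close>.
\<close>

lemma creation_creation: "creation i (creation j u) = - creation j (creation i u)"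
  by (rule ext)
    (auto simp: creation_def wsign_remove mult.commute Diff_insert[symmetric] insert_commute)

lemma annihilation_creation:
  "annihilation i (creation j u) = (if i = j then u else 0) - creation j (annihilation i u)"
proof (rule ext)
  fix I
  consider "i = j" "i \<in> I" | "i = j" "i \<notin> I" | "i \<noteq> j" by blast
  then show "annihilation i (creation j u) I = ((if i = j then u else 0) - creation j (annihilation i u)) I"
  proof cases
    case 3
    then have "insert i I - {j} = insert i (I - {j})" by auto
    with 3 show ?thesis
      by (auto simp: creation_def annihilation_def wsign_remove wsign_insert mult.commute)
  qed (auto simp: creation_def annihilation_def wsign_remove wsign_insert insert_absorb)
qed

lemma clinear_creation: "clinear (creation i)"
  by (rule clinearI) (auto simp: creation_def fun_eq_iff scaleC_add_right mult.commute)

lemma clinear_annihilation: "clinear (annihilation i)"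
  by (rule clinearI) (auto simp: annihilation_def fun_eq_iff scaleC_add_right mult.commute)

lemma lie_basis:
  assumes "finite_dimensional TYPE('l::complex_lie_algebra)"
  shows "inj_on (lie_basis :: nat \<Rightarrow> 'l::complex_lie_algebra) {..<cdim TYPE('l)}"
    and "cvec.independent ((lie_basis :: nat \<Rightarrow> 'l) ` {..<cdim TYPE('l)})"
    and "cvec.span ((lie_basis :: nat \<Rightarrow> 'l) ` {..<cdim TYPE('l)}) = UNIV"
proof -
  obtain B :: "'l set" where "finite_dimensional_vector_space scaleC B"
    using assms by (rule finite_dimensional_basis)
  then interpret fd: finite_dimensional_vector_space scaleC B .
  have "card B = cdim TYPE('l)" using fd.dim_UNIV by (simp add: cdim_def)
  then obtain e where "bij_betw e {..<cdim TYPE('l)} B"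
    using ex_bij_betw_nat_finite[OF fd.finite_Basis] by (metis lessThan_atLeast0)
  then have "\<exists>e :: nat \<Rightarrow> 'l. inj_on e {..<cdim TYPE('l)} \<and>
      cvec.independent (e ` {..<cdim TYPE('l)}) \<and> cvec.span (e ` {..<cdim TYPE('l)}) = UNIV"
    using fd.independent_Basis fd.span_Basis by (intro exI[of _ e]) (auto simp: bij_betw_def)
  from someI_ex[OF this]
  show "inj_on (lie_basis :: nat \<Rightarrow> 'l) {..<cdim TYPE('l)}"
    and "cvec.independent ((lie_basis :: nat \<Rightarrow> 'l) ` {..<cdim TYPE('l)})"
    and "cvec.span ((lie_basis :: nat \<Rightarrow> 'l) ` {..<cdim TYPE('l)}) = UNIV"
    by (simp_all add: lie_basis_def)
qed

lemma clinear_coord: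
  assumes "finite_dimensional TYPE('l::complex_lie_algebra)"
  shows "coord (l + m) i = coord l i + coord (m :: 'l::complex_lie_algebra) i"
    and "coord (a *\<^sub>C l) i = a * coord l i"
  using lie_basis[OF assms] by (simp_all add: coord_def cvec.representation_add cvec.representation_scale)

lemma coord_lie_basis:
  assumes "finite_dimensional TYPE('l::complex_lie_algebra)" "i < cdim TYPE('l)" "j < cdim TYPE('l)"
  shows "coord (lie_basis i :: 'l) j = (if i = j then 1 else 0)"
  using lie_basis[OF assms(1)] assms(2,3)
  by (auto simp: coord_def cvec.representation_basis dest: inj_onD)

lemma coord_expansion:
  assumes "finite_dimensional TYPE('l::complex_lie_algebra)"
  shows "(\<Sum>i<cdim TYPE('l). coord l i *\<^sub>C lie_basis i) = (l :: 'l)"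
proof -
  note b = lie_basis[OF assms]
  have "(\<Sum>i<cdim TYPE('l). coord l i *\<^sub>C lie_basis i) =
      (\<Sum>b\<in>lie_basis ` {..<cdim TYPE('l)}. cvec.representation (lie_basis ` {..<cdim TYPE('l)}) l b *\<^sub>C b)"
    using b(1) by (simp add: sum.reindex coord_def)
  also have "\<dots> = l"
    using b by (intro cvec.sum_representation_eq) auto
  finally show ?thesis .
qed

text \<open>
  The chains of degree \<open>p\<close> with coefficients in a subspace \<open>V\<close> of \<open>X\<close>. Allowing a subspace makes it
  possible to decompose \<open>X\<close> into submodules without passing to other types.
\<close>

definition chains ::
    "'l::complex_lie_algebra itself \<Rightarrow> nat \<Rightarrow> 'x::complex_vector set \<Rightarrow> (nat set \<Rightarrow> 'x) set" where
  "chains _ p V = {u. \<forall>I. if I \<in> indices TYPE('l) p then u I \<in> V else u I = 0}"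

definition single :: "nat set \<Rightarrow> 'x::complex_vector \<Rightarrow> nat set \<Rightarrow> 'x" where
  "single I x = (\<lambda>J. if J = I then x else 0)"

lemma single_in_chains: "I \<in> indices TYPE('l::complex_lie_algebra) p \<Longrightarrow> x \<in> V \<Longrightarrow> cvec.subspace V \<Longrightarrow> 
   single I x \<in> chains TYPE('l) p V"
  by (auto simp: chains_def single_def cvec.subspace_0)

lemma finite_indices: "finite (indices TYPE('l::complex_lie_algebra) p)"
  by (rule finite_subset[of _ "Pow {..<cdim TYPE('l)}"]) (auto simp: indices_def)

lemma sum_fun_apply: "(\<Sum>i\<in>A. f i) x = (\<Sum>i\<in>A. f i x)" for f :: "'i \<Rightarrow> 'a \<Rightarrow> 'b::comm_monoid_add"
  by (induction A rule: infinite_finite_induct) auto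

lemma chains_sum_single:
  assumes "u \<in> chains TYPE('l::complex_lie_algebra) p V"
  shows "u = (\<Sum>I\<in>indices TYPE('l) p. single I (u I))"
proof (rule ext)
  fix J
  show "u J = (\<Sum>I\<in>indices TYPE('l) p. single I (u I)) J"
    using assms by (auto simp: sum_fun_apply single_def chains_def finite_indices sum.delta split: if_splits)
qed

lemma subspace_chains: "cvec.subspace V \<Longrightarrow> cvec.subspace (chains TYPE('l::complex_lie_algebra) p V)"
  by (auto simp: cvec.subspace_def chains_def split: if_splits)

lemma creation_chains:
  assumes V: "cvec.subspace V" and "i < cdim TYPE('l::complex_lie_algebra)"
    and u: "u \<in> chains TYPE('l) p V"
  shows "creation i u \<in> chains TYPE('l) (Suc p) V"
  unfolding chains_def
proof (intro CollectI allI)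
  fix I
  consider "i \<notin> I" | "i \<in> I" by blast
  then show "if I \<in> indices TYPE('l) (Suc p) then creation i u I \<in> V else creation i u I = 0"
  proof cases
    case 2
    then have "I - {i} \<in> indices TYPE('l) p \<longleftrightarrow> I \<in> indices TYPE('l) (Suc p)"
      using assms(2) card_Suc_Diff1[of I i] finite_subset[of I "{..<cdim TYPE('l)}"]
        finite_subset[of "I - {i}" "{..<cdim TYPE('l)}"]
      by (auto simp: indices_def)
    then show ?thesis using u V 2 by (auto simp: creation_def chains_def cvec.subspace_scale split: if_splits)
  qed (use V in \<open>auto simp: creation_def cvec.subspace_0\<close>)
qed

lemma annihilation_chains:
  assumes V: "cvec.subspace V" and "i < cdim TYPE('l::complex_lie_algebra)"
    and u: "u \<in> chains TYPE('l) (Suc p) V"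
  shows "annihilation i u \<in> chains TYPE('l) p V"
  unfolding chains_def
proof (intro CollectI allI)
  fix I
  consider "i \<in> I" | "i \<notin> I" by blast
  then show "if I \<in> indices TYPE('l) p then annihilation i u I \<in> V else annihilation i u I = 0"
  proof cases
    case 2
    have "card (insert i I) = Suc (card I)" if "I \<subseteq> {..<cdim TYPE('l)}"
      using 2 finite_subset[OF that] by simp
    moreover have "insert i I \<subseteq> {..<cdim TYPE('l)} \<longleftrightarrow> I \<subseteq> {..<cdim TYPE('l)}"
      using assms(2) by simp
    ultimately have "insert i I \<in> indices TYPE('l) (Suc p) \<longleftrightarrow> I \<in> indices TYPE('l) p"
      unfolding indices_def by (metis (mono_tags, lifting) mem_Collect_eq nat.inject)
    then show ?thesis using u V 2 by (auto simp: annihilation_def chains_def cvec.subspace_scale split: if_splits)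
  qed (use V in \<open>auto simp: annihilation_def cvec.subspace_0\<close>)
qed

lemma annihilation_chains_0:
  assumes u: "u \<in> chains TYPE('l::complex_lie_algebra) 0 V"
  shows "annihilation i u = 0"
proof (rule ext)
  fix I
  have "insert i I \<notin> indices TYPE('l) 0"
    using finite_subset[of "insert i I" "{..<cdim TYPE('l)}"] card_gt_0_iff[of "insert i I"]
    by (auto simp: indices_def simp del: card_gt_0_iff)
  then show "annihilation i u I = 0 I" using u by (auto simp: annihilation_def chains_def)
qed

text \<open>
  Exterior multiplication by \<open>l\<close> from the left, and the derivation of the exterior algebra that
  extends \<open>ad l\<close>; neither of them acts on the coefficients in \<open>X\<close>.
\<close>

definition wedge :: "'l::complex_lie_algebra \<Rightarrow> (nat set \<Rightarrow> 'x::complex_vector) \<Rightarrow> nat set \<Rightarrow> 'x" where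
  "wedge l u = (\<Sum>i<cdim TYPE('l). coord l i *\<^sub>C creation i u)"

definition derivation :: "'l::complex_lie_algebra \<Rightarrow> (nat set \<Rightarrow> 'x::complex_vector) \<Rightarrow> nat set \<Rightarrow> 'x" where
  "derivation l u = (\<Sum>k<cdim TYPE('l). wedge (bracket l (lie_basis k)) (annihilation k u))"

lemma clinear_sum: "(\<And>i. i \<in> A \<Longrightarrow> clinear (f i)) \<Longrightarrow> clinear (\<lambda>x. \<Sum>i\<in>A. f i x)"
  by (rule clinearI) (simp_all add: cpair.linear_add cpair.linear_scale sum.distrib cvec.scale_sum_right)

lemma clinear_compose: "clinear f \<Longrightarrow> clinear g \<Longrightarrow> clinear (\<lambda>x. g (f x))"
  by (rule clinearI) (simp_all add: cpair.linear_add cpair.linear_scale)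

lemma clinear_wedge: "clinear (wedge l)"
  unfolding wedge_def
  by (intro clinear_sum clinearI)
    (simp_all add: cpair.linear_add[OF clinear_creation] cpair.linear_scale[OF clinear_creation]
      scaleC_add_right mult.commute)

lemma clinear_derivation: "clinear (derivation l)"
  unfolding derivation_def
  by (intro clinear_sum clinear_compose[OF clinear_annihilation clinear_wedge])

lemma wedge_chains:
  assumes V: "cvec.subspace V" and u: "u \<in> chains TYPE('l) p V"
  shows "wedge (l :: 'l::complex_lie_algebra) u \<in> chains TYPE('l) (Suc p) V"
  unfolding wedge_def
  by (intro cvec.subspace_sum subspace_chains V cvec.subspace_scale creation_chains u) simp

lemma derivation_chains:
  assumes V: "cvec.subspace V" and u: "u \<in> chains TYPE('l) p V"
  shows "derivation (l :: 'l::complex_lie_algebra) u \<in> chains TYPE('l) p V"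
proof (cases p)
  case 0
  then have "derivation l u = 0"
    using u by (simp add: derivation_def annihilation_chains_0 cpair.linear_0[OF clinear_wedge])
  then show ?thesis using cvec.subspace_0[OF subspace_chains[OF V]] by simp
next
  case (Suc q)
  show ?thesis unfolding derivation_def Suc
    by (intro cvec.subspace_sum subspace_chains V wedge_chains annihilation_chains u[unfolded Suc]) auto
qed

lemma creation_single:
  assumes "i \<notin> I"
  shows "creation i (single I x) = single (insert i I) (wsign i I *\<^sub>C x)"
  using assms by (auto simp: fun_eq_iff creation_def single_def wsign_insert)

context
  assumes fd: "finite_dimensional TYPE('l::complex_lie_algebra)"
begin

lemma clinear_wedge_left: "clinear (\<lambda>l :: 'l. wedge l u)"
  unfolding wedge_def
  by (rule clinearI) (simp_all add: clinear_coord[OF fd] scaleC_add_left sum.distrib cvec.scale_sum_right)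

lemma wedge_lie_basis: "i < cdim TYPE('l) \<Longrightarrow> wedge (lie_basis i :: 'l) u = creation i u"
  unfolding wedge_def
  by (subst sum.cong[OF refl, where h = "\<lambda>j. if j = i then creation i u else 0"])
    (auto simp: coord_lie_basis[OF fd] sum.delta)

lemma wedge_wedge: "wedge (l :: 'l) (wedge (m :: 'l) u) = - wedge m (wedge l u)"
proof -
  have "wedge l (wedge m u) =
      (\<Sum>i<cdim TYPE('l). \<Sum>j<cdim TYPE('l). (coord l i * coord m j) *\<^sub>C creation i (creation j u))" for l m :: 'l
    by (simp add: wedge_def cpair.linear_sum[OF clinear_creation] cpair.linear_scale[OF clinear_creation] cvec.scale_sum_right)
  note expand = this
  show ?thesis unfolding expand
    by (subst sum.swap, subst creation_creation) (simp add: sum_negf mult.commute)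
qed

lemma annihilation_wedge:
  assumes "k < cdim TYPE('l)"
  shows "annihilation k (wedge (m :: 'l) u) = coord m k *\<^sub>C u - wedge m (annihilation k u)"
proof -
  have "annihilation k (wedge m u) =
      (\<Sum>i<cdim TYPE('l). coord m i *\<^sub>C ((if k = i then u else 0) - creation i (annihilation k u)))"
    by (simp add: wedge_def cpair.linear_sum[OF clinear_annihilation] cpair.linear_scale[OF clinear_annihilation]
        annihilation_creation)
  also have "\<dots> = (\<Sum>i<cdim TYPE('l). if k = i then coord m k *\<^sub>C u else 0) - wedge m (annihilation k u)"
    unfolding wedge_def sum_subtractf[symmetric]
    by (intro sum.cong) (simp_all add: cvec.scale_right_diff_distrib)
  finally show ?thesis using assms by simp
qed

lemma derivation_wedge:
  "derivation (l :: 'l) (wedge m u) = wedge (bracket l m) u + wedge m (derivation l u)"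
proof -
  have "derivation l (wedge m u) =
      (\<Sum>k<cdim TYPE('l). coord m k *\<^sub>C wedge (bracket l (lie_basis k)) u
         + wedge m (wedge (bracket l (lie_basis k)) (annihilation k u)))"
    unfolding derivation_def
    by (intro sum.cong) (simp_all add: annihilation_wedge cpair.linear_diff[OF clinear_wedge]
        cpair.linear_scale[OF clinear_wedge] wedge_wedge[of _ m])
  also have "\<dots> = wedge (\<Sum>k<cdim TYPE('l). bracket l (coord m k *\<^sub>C lie_basis k)) u + wedge m (derivation l u)"
    by (simp add: sum.distrib cpair.linear_sum[OF clinear_wedge] derivation_def
        cpair.linear_sum[OF clinear_wedge_left] cpair.linear_scale[OF clinear_wedge_left] bracket_scaleC_right)
  also have "(\<Sum>k<cdim TYPE('l). bracket l (coord m k *\<^sub>C lie_basis k)) = bracket l m"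
    by (simp add: coord_expansion[OF fd] flip: cpair.linear_sum[OF clinear_bracket_right])
  finally show ?thesis .
qed

text \<open>
  Chains are generated from degree \<open>0\<close> by exterior multiplications. Identities between operators whose
  commutation with \<open>wedge\<close> is known therefore only need to be checked in degree \<open>0\<close>.
\<close>

lemma chains_induct [consumes 1, case_names zero add single wedge]:
  assumes u: "u \<in> chains TYPE('l) p V"
    and zero: "P 0"
    and add: "\<And>u v. P u \<Longrightarrow> P v \<Longrightarrow> P (u + v)"
    and single: "\<And>x. P (single {} x)"
    and wedge: "\<And>l u q. u \<in> chains TYPE('l) q UNIV \<Longrightarrow> P u \<Longrightarrow> P (wedge (l :: 'l) u)"
  shows "P u"
proof -
  have P: "P (single I x)" if "finite I" "I \<subseteq> {..<cdim TYPE('l)}" for I x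
    using that
  proof (induction I arbitrary: x)
    case (insert i I)
    \<comment> \<open>Multiplication by \<open>e i\<close> gives the sign once more, and signs square to \<open>1\<close>.\<close>
    then have "single I (wsign i I *\<^sub>C x) \<in> chains TYPE('l) (card I) UNIV"
      by (intro single_in_chains) (auto simp: indices_def cvec.subspace_UNIV)
    then have "P (wedge (lie_basis i :: 'l) (single I (wsign i I *\<^sub>C x)))"
      using insert by (intro wedge insert.IH) auto
    then show ?case using insert by (simp add: wedge_lie_basis creation_single)
  qed (rule single)
  have "P (\<Sum>I\<in>A. single I (u I))" if "A \<subseteq> indices TYPE('l) p" for A
    using finite_subset[OF that finite_indices] that
    by (induction A rule: finite_induct)
      (auto simp: zero indices_def intro!: add P intro: finite_subset[OF _ finite_lessThan])
  then have "P (\<Sum>I\<in>indices TYPE('l) p. single I (u I))" by blast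
  then show ?thesis by (simp only: chains_sum_single[OF u, symmetric])
qed

lemma derivation_single_empty: "derivation (l :: 'l) (single {} x) = 0"
proof -
  have "single {} x \<in> chains TYPE('l) 0 UNIV"
    by (rule single_in_chains) (auto simp: indices_def cvec.subspace_UNIV)
  then show ?thesis by (simp add: derivation_def annihilation_chains_0 cpair.linear_0[OF clinear_wedge])
qed

text \<open>
  On \<open>L\<close> the derivation is \<open>ad l\<close>, which is nilpotent; the Leibniz argument carries nilpotency from
  \<open>u\<close> to \<open>wedge m u\<close>. The exponent grows with the degree.
\<close>

lemma derivation_nilpotent:
  assumes "nilpotent TYPE('l)" "u \<in> chains TYPE('l) p V"
  shows "\<exists>N. (derivation (l :: 'l) ^^ N) u = 0"
  using assms(2)
proof (induction rule: chains_induct)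
  case zero
  show ?case by (auto intro: exI[of _ 0])
next
  case (add u v)
  then obtain i j where ij: "(derivation l ^^ i) u = 0" "(derivation l ^^ j) v = 0" by blast
  note lin = clinear_funpow[OF clinear_derivation]
  have "(derivation l ^^ (i + j)) u = 0"
    using ij by (subst add.commute) (simp add: funpow_add cpair.linear_0[OF lin])
  moreover have "(derivation l ^^ (i + j)) v = 0"
    using ij by (simp add: funpow_add cpair.linear_0[OF lin])
  ultimately show ?case by (intro exI[of _ "i + j"]) (simp only: cpair.linear_add[OF lin] add_0)
next
  case (single x)
  show ?case by (intro exI[of _ 1]) (simp add: derivation_single_empty)
next
  case (wedge m u)
  then obtain k where k: "(derivation l ^^ k) u = 0" by blast
  obtain N where N: "\<And>m. (bracket l ^^ N) m = 0" using ad_nilpotent[OF assms(1)] by blast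
  have "(derivation l ^^ (N + k)) (wedge m u) = 0"
    by (rule leibniz_nilpotent[where T = "derivation l" and \<beta> = wedge, OF clinear_derivation _ _ derivation_wedge N k])
      (simp_all add: cpair.linear_0[OF clinear_wedge] cpair.linear_0[OF clinear_wedge_left])
  then show ?case by blast
qed

lemma derivation_bracket:
  assumes "u \<in> chains TYPE('l) p V"
  shows "derivation (l :: 'l) (derivation m u) = derivation (bracket l m) u + derivation m (derivation l u)"
  using assms
proof (induction rule: chains_induct)
  case zero
  show ?case by (simp only: cpair.linear_0[OF clinear_derivation] add_0)
next
  case (add u v)
  then show ?case by (simp only: cpair.linear_add[OF clinear_derivation] add_ac)
next
  case (single x)
  show ?case by (simp only: derivation_single_empty cpair.linear_0[OF clinear_derivation] add_0)
next
  case (wedge k u)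
  have "bracket l (bracket m k) = bracket (bracket l m) k + bracket m (bracket l k)"
    using jacobi[of l m k] bracket_antisym[of k "bracket l m"] bracket_antisym[of k l]
      cpair.linear_neg[OF clinear_bracket_right, of m "bracket l k"]
    by (simp add: algebra_simps add_eq_0_iff)
  then have "wedge (bracket l (bracket m k)) u
      = wedge (bracket (bracket l m) k) u + wedge (bracket m (bracket l k)) u"
    by (simp add: cpair.linear_add[OF clinear_wedge_left])
  then show ?case
    using wedge by (simp only: derivation_wedge cpair.linear_add[OF clinear_derivation] cpair.linear_add[OF clinear_wedge] add_ac)
qed

end

text \<open>
  In Cartan's formula the summand of the Koszul differential for \<open>a < b\<close> contributes two terms that
  are exchanged by swapping \<open>a\<close> and \<open>b\<close>.
\<close>

lemma sum_less_pairs: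
  fixes G :: "nat \<Rightarrow> nat \<Rightarrow> 'a::comm_monoid_add"
  assumes "\<And>a. G a a = 0"
  shows "(\<Sum>b<n. \<Sum>a<b. G a b + G b a) = (\<Sum>a<n. \<Sum>b<n. G a b)"
  by (induction n) (simp_all add: assms sum.distrib ac_simps)

section \<open>The Koszul differential and Cartan's formula\<close>

text \<open>
  A nilpotent perturbation of an invertible operator that commutes with it is invertible. Solving
  \<open>R v + A v = u\<close> starts with \<open>w = R\<^sup>-\<^sup>1 u\<close>, which leaves the error \<open>A w\<close>; as \<open>A\<close> and \<open>R\<close> commute, that
  error is killed by a smaller power of \<open>A\<close> than \<open>u\<close>.
\<close>

lemma nilpotent_perturbation:
  fixes R A :: "'c::complex_vector \<Rightarrow> 'c"
  assumes R: "clinear R" and A: "clinear A" and C: "cvec.subspace C"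
    and AC: "\<And>u. u \<in> C \<Longrightarrow> A u \<in> C" and inj: "inj_on R C" and surj: "R ` C = C"
    and commute: "\<And>u. A (R u) = R (A u)"
    and nil: "\<And>u. u \<in> C \<Longrightarrow> \<exists>N. (A ^^ N) u = 0"
  shows "u \<in> C \<Longrightarrow> \<exists>v \<in> C. R v + A v = u"
    and "v \<in> C \<Longrightarrow> R v + A v = 0 \<Longrightarrow> v = 0"
proof -
  have powC: "(A ^^ k) u \<in> C" if "u \<in> C" for k u using that AC by (induction k) auto
  have pow: "R ((A ^^ k) u) = (A ^^ k) (R u)" for k u
    by (induction k) (simp_all flip: commute)
  have inj0: "u = 0" if "u \<in> C" "R u = 0" for u
    using inj_onD[OF inj, of u 0] that C by (simp add: cpair.linear_0[OF R] cvec.subspace_0)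
  have "\<exists>v \<in> C. R v + A v = u" if "u \<in> C" "(A ^^ N) u = 0" for u N
    using that
  proof (induction N arbitrary: u)
    case 0
    then show ?case using C by (auto simp: cvec.subspace_0 cpair.linear_0[OF R] cpair.linear_0[OF A] intro!: bexI[of _ 0])
  next
    case (Suc N)
    obtain w where w: "w \<in> C" "u = R w" using surj Suc.prems(1) by blast
    have "R ((A ^^ N) (A w)) = 0"
      using Suc.prems(2) w(2) by (simp add: pow commute[symmetric] funpow_swap1)
    then have "(A ^^ N) (A w) = 0" using inj0 powC AC w(1) by blast
    then obtain v where v: "v \<in> C" "R v + A v = A w" using Suc.IH AC w(1) by blast
    have "R (w - v) + A (w - v) = u"
      using v(2) w(2) by (simp add: cpair.linear_diff[OF R] cpair.linear_diff[OF A] algebra_simps)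
    then show ?case using cvec.subspace_diff[OF C w(1) v(1)] by blast
  qed
  then show "u \<in> C \<Longrightarrow> \<exists>v \<in> C. R v + A v = u" using nil by blast
  assume v: "v \<in> C" "R v + A v = 0"
  have "v = 0" if "(A ^^ k) v = 0" for k
    using that
  proof (induction k)
    case (Suc k)
    have "R v = - A v" using v(2) by (simp add: eq_neg_iff_add_eq_0)
    then have "R ((A ^^ k) v) = - (A ^^ Suc k) v"
      by (simp add: pow cpair.linear_neg[OF clinear_funpow[OF A]] funpow_swap1)
    then show ?case using Suc inj0 powC v(1) by simp
  qed simp
  then show "v = 0" using nil v(1) by blast
qed

context lie_module
begin

text \<open>
  The Koszul differential in terms of annihilation operators, and the operators by which \<open>L\<close> acts
  on \<open>X \<otimes> \<and>L\<close> as on a tensor product. The minus sign before the bracket term comes from the order of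
  the two contractions: for \<open>a < b\<close> at positions \<open>i < j\<close> of \<open>I\<close>, contracting \<open>e I\<close> first with
  \<open>b\<close> and then with \<open>a\<close> gives the sign \<open>(-1)^(i + j)\<close>.
\<close>

definition act :: "'l \<Rightarrow> (nat set \<Rightarrow> 'x) \<Rightarrow> nat set \<Rightarrow> 'x" where
  "act l u = (\<lambda>I. \<rho> l (u I))"

definition koszul :: "(nat set \<Rightarrow> 'x) \<Rightarrow> nat set \<Rightarrow> 'x" where
  "koszul u = (\<Sum>i<cdim TYPE('l). act (lie_basis i) (annihilation i u)) -
     (\<Sum>b<cdim TYPE('l). \<Sum>a<b.
        wedge (bracket (lie_basis a) (lie_basis b :: 'l)) (annihilation a (annihilation b u)))"

definition lie_derivative :: "'l \<Rightarrow> (nat set \<Rightarrow> 'x) \<Rightarrow> nat set \<Rightarrow> 'x" where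
  "lie_derivative l u = act l u + derivation l u"

lemma clinear_act: "clinear (act l)"
  by (rule clinearI) (auto simp: act_def fun_eq_iff action_simps)

lemma clinear_act_left: "clinear (\<lambda>l. act l u)"
  by (rule clinearI) (auto simp: act_def fun_eq_iff action_simps)

lemma clinear_diff: "clinear f \<Longrightarrow> clinear g \<Longrightarrow> clinear (\<lambda>x. f x - g x)"
  by (rule clinearI) (simp_all add: cpair.linear_add cpair.linear_scale cvec.scale_right_diff_distrib)

lemma clinear_koszul: "clinear koszul"
  unfolding koszul_def[abs_def]
  by (intro clinear_diff clinear_sum clinear_compose[OF clinear_annihilation clinear_act]
      clinear_compose[OF clinear_annihilation clinear_wedge] clinear_compose[OF clinear_annihilation] clinear_wedge)

lemma clinear_lie_derivative: "clinear (lie_derivative l)"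
  unfolding lie_derivative_def[abs_def]
  by (rule clinearI) (simp_all only: cpair.linear_add[OF clinear_act] cpair.linear_add[OF clinear_derivation]
      cpair.linear_scale[OF clinear_act] cpair.linear_scale[OF clinear_derivation] add_ac scaleC_add_right)

lemma act_creation: "act l (creation i u) = creation i (act l u)"
  by (auto simp: act_def creation_def fun_eq_iff action_simps)

lemma act_annihilation: "act l (annihilation i u) = annihilation i (act l u)"
  by (auto simp: act_def annihilation_def fun_eq_iff action_simps)

lemma act_wedge: "act l (wedge m u) = wedge m (act l u)"
  by (simp add: wedge_def cpair.linear_sum[OF clinear_act] cpair.linear_scale[OF clinear_act] act_creation)

lemma act_derivation: "act l (derivation m u) = derivation m (act l u)"
  by (simp add: derivation_def cpair.linear_sum[OF clinear_act] act_wedge act_annihilation)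

lemma act_chains: "submodule V \<Longrightarrow> u \<in> chains TYPE('l) p V \<Longrightarrow> act l u \<in> chains TYPE('l) p V"
  by (auto simp: chains_def act_def submodule_def action_simps split: if_splits)

lemma koszul_chains_0: "u \<in> chains TYPE('l) 0 V \<Longrightarrow> koszul u = 0"
  by (simp add: koszul_def annihilation_chains_0[where 'l = 'l] cpair.linear_0[OF clinear_act]
      cpair.linear_0[OF clinear_annihilation] cpair.linear_0[OF clinear_wedge])

lemma koszul_chains:
  assumes V: "submodule V" and u: "u \<in> chains TYPE('l) (Suc p) V"
  shows "koszul u \<in> chains TYPE('l) p V"
proof -
  have sV: "cvec.subspace V" using V by (simp add: submodule_def)
  note sC = subspace_chains[OF sV, where 'l = 'l]
  have "wedge (bracket (lie_basis a) (lie_basis b :: 'l)) (annihilation a (annihilation b u)) \<in> chains TYPE('l) p V"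
    if "a < cdim TYPE('l)" "b < cdim TYPE('l)" for a b
  proof (cases p)
    case 0
    have "annihilation b u \<in> chains TYPE('l) 0 V"
      using annihilation_chains[OF sV that(2) u] 0 by simp
    then show ?thesis
      by (simp add: annihilation_chains_0[where 'l = 'l] cpair.linear_0[OF clinear_wedge] cvec.subspace_0[OF sC])
  next
    case (Suc q)
    show ?thesis unfolding Suc
      by (intro wedge_chains sV annihilation_chains that u[unfolded Suc])
  qed
  then show ?thesis
    unfolding koszul_def
    by (intro cvec.subspace_diff sC cvec.subspace_sum act_chains V annihilation_chains sV u) auto
qed

lemma act_single: "act l (single I x) = single I (\<rho> l x)"
  by (auto simp: act_def single_def fun_eq_iff action_simps)

end

locale nilpotent_lie_module = lie_module \<rho>
  for \<rho> :: "'l::complex_lie_algebra \<Rightarrow> 'x::complex_vector \<Rightarrow> 'x" +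
  assumes fdX: "finite_dimensional TYPE('x)"
    and fdL: "finite_dimensional TYPE('l)"
    and nilL: "nilpotent TYPE('l)"
begin

text \<open>
  Exterior multiplication by \<open>l\<close> is a homotopy between \<open>0\<close> and the action of \<open>l\<close>, so \<open>L\<close> acts trivially
  on Koszul homology. Moving \<open>wedge l\<close> to the left through the contractions produces, besides the
  anticommutator, one term for each contraction that meets \<open>l\<close>: from the first sum
  \<open>act l u\<close>, from the second one \<open>derivation l u\<close>.
\<close>

lemma cartan_formula: "koszul (wedge l u) + wedge l (koszul u) = lie_derivative l u"
proof -
  let ?n = "cdim TYPE('l)" and ?e = "lie_basis :: nat \<Rightarrow> 'l"
  let ?W = "\<lambda>a b. wedge (bracket (?e a) (?e b)) (annihilation a (annihilation b u))"
  let ?S1 = "\<Sum>i<?n. act (?e i) (annihilation i u)"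
  let ?S2 = "\<Sum>b<?n. \<Sum>a<b. ?W a b"
  define G where "G = (\<lambda>a b. coord l b *\<^sub>C wedge (bracket (?e a) (?e b)) (annihilation a u))"
  have "(\<Sum>i<?n. act (?e i) (annihilation i (wedge l u))) =
      (\<Sum>i<?n. coord l i *\<^sub>C act (?e i) u - wedge l (act (?e i) (annihilation i u)))"
    by (intro sum.cong) (simp_all add: annihilation_wedge[OF fdL] cpair.linear_diff[OF clinear_act]
      cpair.linear_scale[OF clinear_act] act_wedge)
  also have "\<dots> = act (\<Sum>i<?n. coord l i *\<^sub>C ?e i) u - wedge l ?S1"
    by (simp add: sum_subtractf cpair.linear_sum[OF clinear_act_left] cpair.linear_scale[OF clinear_act_left]
        cpair.linear_sum[OF clinear_wedge])
  also have "\<dots> = act l u - wedge l ?S1" by (simp add: coord_expansion[OF fdL])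
  finally have A: "(\<Sum>i<?n. act (?e i) (annihilation i (wedge l u))) = act l u - wedge l ?S1" .
  \<comment> \<open>The two contractions each meet \<open>l\<close> once; antisymmetry of the bracket makes the terms symmetric.\<close>
  have summand: "wedge (bracket (?e a) (?e b)) (annihilation a (annihilation b (wedge l u))) =
      G a b + G b a - wedge l (?W a b)" if "a < ?n" "b < ?n" for a b
  proof -
    have "bracket (?e b) (?e a) = - bracket (?e a) (?e b)" by (rule bracket_antisym)
    then have "G b a = - (coord l a *\<^sub>C wedge (bracket (?e a) (?e b)) (annihilation b u))"
      by (simp add: G_def cpair.linear_neg[OF clinear_wedge_left[OF fdL]])
    then show ?thesis
      using that
      by (simp add: annihilation_wedge[OF fdL] cpair.linear_diff[OF clinear_annihilation]
        cpair.linear_scale[OF clinear_annihilation] cpair.linear_diff[OF clinear_wedge]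
        cpair.linear_scale[OF clinear_wedge] wedge_wedge[OF fdL, of _ l] G_def)
  qed
  have "(\<Sum>b<?n. \<Sum>a<b. wedge (bracket (?e a) (?e b)) (annihilation a (annihilation b (wedge l u)))) =
      (\<Sum>b<?n. \<Sum>a<b. (G a b + G b a) - wedge l (?W a b))"
    by (intro sum.cong refl summand) auto
  also have "\<dots> = (\<Sum>b<?n. \<Sum>a<b. G a b + G b a) - wedge l ?S2"
    by (simp only: sum_subtractf cpair.linear_sum[OF clinear_wedge])
  also have "(\<Sum>b<?n. \<Sum>a<b. G a b + G b a) = (\<Sum>a<?n. \<Sum>b<?n. G a b)"
    by (rule sum_less_pairs) (simp add: G_def bracket_self cpair.linear_0[OF clinear_wedge_left[OF fdL]])
  also have "\<dots> = (\<Sum>a<?n. wedge (bracket (?e a) (\<Sum>b<?n. coord l b *\<^sub>C ?e b)) (annihilation a u))"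
    by (simp add: G_def cpair.linear_sum[OF clinear_bracket_right] cpair.linear_sum[OF clinear_wedge_left[OF fdL]]
       cpair.linear_scale[OF clinear_bracket_right] cpair.linear_scale[OF clinear_wedge_left[OF fdL]])
  also have "\<dots> = (\<Sum>a<?n. - wedge (bracket l (?e a)) (annihilation a u))"
    unfolding coord_expansion[OF fdL]
    by (intro sum.cong refl, subst bracket_antisym) (simp add: cpair.linear_neg[OF clinear_wedge_left[OF fdL]])
  also have "\<dots> = - derivation l u" by (simp add: derivation_def sum_negf)
  finally have B: "(\<Sum>b<?n. \<Sum>a<b. wedge (bracket (?e a) (?e b)) (annihilation a (annihilation b (wedge l u)))) =
      - derivation l u - wedge l ?S2" .
  have C: "wedge l (koszul u) = wedge l ?S1 - wedge l ?S2"
    unfolding koszul_def by (rule cpair.linear_diff[OF clinear_wedge])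
  show ?thesis
    unfolding C unfolding koszul_def A B lie_derivative_def by simp
qed

lemma lie_derivative_wedge:
  "lie_derivative l (wedge m u) = wedge (bracket l m) u + wedge m (lie_derivative l u)"
  by (simp only: lie_derivative_def act_wedge derivation_wedge[OF fdL] cpair.linear_add[OF clinear_wedge] add_ac)

lemma lie_derivative_bracket:
  assumes "u \<in> chains TYPE('l) p V"
  shows "lie_derivative l (lie_derivative m u) =
    lie_derivative (bracket l m) u + lie_derivative m (lie_derivative l u)"
proof -
  have "act l (act m u) = act (bracket l m) u + act m (act l u)"
    by (simp add: act_def fun_eq_iff action_leibniz[of l m])
  then show ?thesis
    unfolding lie_derivative_def
    by (simp only: cpair.linear_add[OF clinear_act] cpair.linear_add[OF clinear_derivation]
      act_derivation derivation_bracket[OF fdL assms, of l m] add_ac)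
qed

text \<open>
  The differential is equivariant. By Cartan's formula the commutator of \<open>koszul\<close> with a
  Lie derivative anticommutes with all \<open>wedge m\<close>, and it vanishes in degree \<open>0\<close>. Consequently
  a preimage of a cycle under an injective Lie derivative is a cycle.
\<close>

lemma lie_derivative_koszul:
  assumes "u \<in> chains TYPE('l) p V"
  shows "koszul (lie_derivative l u) = lie_derivative l (koszul u)"
proof -
  note lin = cpair.linear_0[OF clinear_koszul] cpair.linear_0[OF clinear_lie_derivative]
    cpair.linear_add[OF clinear_koszul] cpair.linear_add[OF clinear_lie_derivative]
    cpair.linear_diff[OF clinear_koszul] cpair.linear_diff[OF clinear_lie_derivative]
  have koszul_wedge: "koszul (wedge m v) = lie_derivative m v - wedge m (koszul v)" for m v
    using cartan_formula[of m v] by (simp only: eq_diff_eq)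
  show ?thesis
    using assms
  proof (induction rule: chains_induct[OF fdL, consumes 1, case_names zero add single wedge])
    case zero
    show ?case by (simp only: lin)
  next
    case (add u v)
    then show ?case by (simp only: lin)
  next
    case (single x)
    have 0: "single {} y \<in> chains TYPE('l) 0 UNIV" for y :: 'x
      by (rule single_in_chains) (auto simp: indices_def cvec.subspace_UNIV)
    have "lie_derivative l (single {} x) = single {} (\<rho> l x)"
      by (simp add: lie_derivative_def derivation_single_empty[OF fdL] act_single)
    then show ?case using koszul_chains_0[OF 0] by (simp only: lin)
  next
    case (wedge m u)
    have "koszul (lie_derivative l (wedge m u)) =
        lie_derivative (bracket l m) u + lie_derivative m (lie_derivative l u)
        - (wedge (bracket l m) (koszul u) + wedge m (lie_derivative l (koszul u)))"
      using wedge(2) by (simp only: lie_derivative_wedge lin koszul_wedge algebra_simps)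
    also have "\<dots> = lie_derivative l (lie_derivative m u) - lie_derivative l (wedge m (koszul u))"
      by (simp only: lie_derivative_bracket[OF wedge(1), of l m] lie_derivative_wedge)
    finally show ?case by (simp only: koszul_wedge lin)
  qed
qed

section \<open>Homology of the Koszul complex\<close>

text \<open>
  If \<open>\<rho> l\<close> is bijective on \<open>V\<close>, then so is \<open>lie_derivative l\<close> on chains, being the sum of the
  bijective operator \<open>act l\<close> and the nilpotent operator \<open>derivation l\<close>, which commute. A cycle \<open>z\<close> is then
  \<open>lie_derivative l v\<close> for some \<open>v\<close>, which is a cycle as well by equivariance and injectivity, and Cartan's
  formula gives \<open>z = koszul (wedge l v)\<close>.
\<close>

lemma acyclic_of_bijective:
  assumes V: "submodule V" and l: "inj_on (\<rho> l) V" "\<rho> l ` V = V"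
    and z: "z \<in> chains TYPE('l) p V" "koszul z = 0"
  shows "\<exists>w \<in> chains TYPE('l) (Suc p) V. koszul w = z"
proof -
  have sV: "cvec.subspace V" using V by (simp add: submodule_def)
  have inj: "inj_on (act l) (chains TYPE('l) q V)" for q
  proof (rule inj_onI, rule ext)
    fix u v I
    assume uv: "u \<in> chains TYPE('l) q V" "v \<in> chains TYPE('l) q V" "act l u = act l v"
    then have "\<rho> l (u I) = \<rho> l (v I)" by (simp add: act_def fun_eq_iff)
    moreover have "u I \<in> V" "v I \<in> V"
      using uv cvec.subspace_0[OF sV] by (auto simp: chains_def split: if_splits)
    ultimately show "u I = v I" using l(1) by (simp add: inj_on_eq_iff)
  qed
  have surj: "act l ` chains TYPE('l) q V = chains TYPE('l) q V" for q
  proof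
    show "act l ` chains TYPE('l) q V \<subseteq> chains TYPE('l) q V" using act_chains[OF V] by blast
    show "chains TYPE('l) q V \<subseteq> act l ` chains TYPE('l) q V"
    proof
      fix u assume u: "u \<in> chains TYPE('l) q V"
      define v where "v = (\<lambda>I. if I \<in> indices TYPE('l) q then inv_into V (\<rho> l) (u I) else 0)"
      have "v \<in> chains TYPE('l) q V"
        using u l(2) by (auto simp: v_def chains_def inv_into_into)
      moreover have "act l v = u"
        using u l(2) by (auto simp: fun_eq_iff v_def chains_def act_def action_simps f_inv_into_f)
      ultimately show "u \<in> act l ` chains TYPE('l) q V" by blast
    qed
  qed
  have nil: "\<exists>N. (derivation l ^^ N) u = 0" if "u \<in> chains TYPE('l) q V" for q u
    using that by (rule derivation_nilpotent[OF fdL nilL])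
  note perturb = nilpotent_perturbation[where R = "act l" and A = "derivation l" and C = "chains TYPE('l) q V" for q,
      OF clinear_act clinear_derivation subspace_chains[OF sV] derivation_chains[OF sV] inj surj
        act_derivation[symmetric], folded lie_derivative_def]
  have onto: "\<exists>v \<in> chains TYPE('l) q V. lie_derivative l v = u" if "u \<in> chains TYPE('l) q V" for u q
    by (rule perturb(1)) (auto intro: nil that)
  have zero: "v = 0" if "v \<in> chains TYPE('l) q V" "lie_derivative l v = 0" for v q
    by (rule perturb(2)[of q]) (auto intro: nil that)
  obtain v where v: "v \<in> chains TYPE('l) p V" "lie_derivative l v = z"
    using onto[OF z(1)] by blast
  have "lie_derivative l (koszul v) = 0"
    using lie_derivative_koszul[OF v(1), of l] v(2) z(2) by simp
  moreover have "\<exists>q. koszul v \<in> chains TYPE('l) q V"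
  proof (cases p)
    case 0
    then show ?thesis using v(1) koszul_chains_0 cvec.subspace_0[OF subspace_chains[OF sV]] by metis
  next
    case (Suc q)
    then show ?thesis using v(1) koszul_chains[OF V] by blast
  qed
  ultimately have "koszul v = 0"
    using zero by blast
  then have "koszul (wedge l v) = z"
    using cartan_formula[of l v] v(2) by (simp add: cpair.linear_0[OF clinear_wedge])
  then show ?thesis using wedge_chains[OF sV v(1)] by blast
qed

text \<open>
  A module without invariant vectors has no Koszul homology: by Engel's theorem its nilpotent part is
  zero, and the remaining summands are covered by the bijective case. The complex of a direct sum of
  submodules is the direct sum of the complexes.
\<close>

lemma acyclic:
  assumes "submodule V" and "\<And>x. x \<in> V \<Longrightarrow> (\<And>l. \<rho> l x = 0) \<Longrightarrow> x = 0"
    and "z \<in> chains TYPE('l) p V" "koszul z = 0"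
  shows "\<exists>w \<in> chains TYPE('l) (Suc p) V. koszul w = z"
proof -
  have "(\<forall>x \<in> V. (\<forall>l. \<rho> l x = 0) \<longrightarrow> x = 0) \<longrightarrow>
      (\<forall>z \<in> chains TYPE('l) p V. koszul z = 0 \<longrightarrow> (\<exists>w \<in> chains TYPE('l) (Suc p) V. koszul w = z))"
    using fdX nilL assms(1)
  proof (induction rule: submodule_induct)
    case (nil V)
    show ?case
    proof (intro impI ballI)
      assume "\<forall>x \<in> V. (\<forall>l. \<rho> l x = 0) \<longrightarrow> x = 0"
      then have V: "V = {0}" using engel_invariant[OF fdL nilL nil(1) _ nil(2)] by blast
      fix z assume "z \<in> chains TYPE('l) p V"
      then have "z = 0" by (auto simp: V chains_def fun_eq_iff split: if_splits)
      moreover have "cvec.subspace V" using nil by (simp add: submodule_def)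
      ultimately show "\<exists>w \<in> chains TYPE('l) (Suc p) V. koszul w = z"
        by (intro bexI[of _ 0]) (auto simp: cpair.linear_0[OF clinear_koszul] intro: cvec.subspace_0 subspace_chains)
    qed
  next
    case (split V V0 V1 l)
    have sub: "cvec.subspace V0" "cvec.subspace V1" using split by (simp_all add: submodule_def)
    have V0V: "V0 \<subseteq> V" and V1V: "V1 \<subseteq> V"
      using split(4) cvec.subspace_0[OF sub(1)] cvec.subspace_0[OF sub(2)] by force+
    show ?case
    proof (intro impI ballI)
      assume inv: "\<forall>x \<in> V. (\<forall>l. \<rho> l x = 0) \<longrightarrow> x = 0"
      fix z assume z: "z \<in> chains TYPE('l) p V" "koszul z = 0"
      have "\<forall>I. \<exists>a b. I \<in> indices TYPE('l) p \<longrightarrow> a \<in> V0 \<and> b \<in> V1 \<and> z I = a + b"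
        using z(1) split(4) by (fastforce simp: chains_def split: if_splits)
      then obtain f g where fg: "\<And>I. I \<in> indices TYPE('l) p \<Longrightarrow> f I \<in> V0 \<and> g I \<in> V1 \<and> z I = f I + g I"
        by metis
      define z0 where "z0 = (\<lambda>I. if I \<in> indices TYPE('l) p then f I else 0)"
      define z1 where "z1 = (\<lambda>I. if I \<in> indices TYPE('l) p then g I else 0)"
      have z01: "z0 \<in> chains TYPE('l) p V0" "z1 \<in> chains TYPE('l) p V1"
        using fg by (auto simp: chains_def z0_def z1_def)
      have "z = z0 + z1"
        using fg z(1) by (auto simp: fun_eq_iff z0_def z1_def chains_def split: if_splits)
      then have sum0: "koszul z0 + koszul z1 = 0"
        using z(2) by (simp only: cpair.linear_add[OF clinear_koszul])
      have "koszul z0 = 0"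
      proof (cases p)
        case 0
        then show ?thesis using z01 koszul_chains_0 by blast
      next
        case (Suc q)
        then have k: "koszul z0 \<in> chains TYPE('l) q V0" "koszul z1 \<in> chains TYPE('l) q V1"
          using z01 split(1,2) by (auto intro: koszul_chains)
        show ?thesis
        proof (rule ext)
          fix I
          have "koszul z0 I + koszul z1 I = 0" using fun_cong[OF sum0, of I] by simp
          then have "koszul z0 I = - koszul z1 I" by (simp add: eq_neg_iff_add_eq_0)
          moreover have "koszul z0 I \<in> V0" "koszul z1 I \<in> V1"
            using k sub by (auto simp: chains_def cvec.subspace_0 split: if_splits)
          ultimately have "koszul z0 I \<in> V0 \<inter> V1" using sub by (simp add: cvec.subspace_neg)
          then show "koszul z0 I = 0 I" using split(3) by simp
        qed
      qed
      then have "koszul z1 = 0" using sum0 by simp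
      obtain w0 where w0: "w0 \<in> chains TYPE('l) (Suc p) V0" "koszul w0 = z0"
        using split(7) inv V0V z01(1) \<open>koszul z0 = 0\<close> by blast
      obtain w1 where w1: "w1 \<in> chains TYPE('l) (Suc p) V1" "koszul w1 = z1"
        using acyclic_of_bijective[OF split(2,5,6) z01(2) \<open>koszul z1 = 0\<close>] by blast
      have "w0 + w1 \<in> chains TYPE('l) (Suc p) V"
        using w0(1) w1(1) split(4) by (auto simp: chains_def split: if_splits)
      moreover have "koszul (w0 + w1) = z"
        using w0(2) w1(2) \<open>z = z0 + z1\<close> by (simp only: cpair.linear_add[OF clinear_koszul])
      ultimately show "\<exists>w \<in> chains TYPE('l) (Suc p) V. koszul w = z" by blast
    qed
  qed
  then show ?thesis using assms by blast
qed

text \<open>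
  An invariant vector gives a cycle in top degree. The space of multiples of
  \<open>x \<otimes> e 0 \<and> \<dots> \<and> e (n - 1)\<close> is stable under the nilpotent \<open>derivation l\<close>, which therefore
  vanishes on it (\<open>ad l\<close> has trace \<open>0\<close>). Hence all Lie derivatives of this chain vanish, and by Cartan's
  formula every \<open>wedge l\<close> annihilates its boundary. In degree \<open>n - 1\<close> this is only possible for \<open>0\<close>.
\<close>

lemma koszul_top:
  assumes x: "\<And>l. \<rho> l x = 0"
  shows "koszul (single {..<cdim TYPE('l)} x) = 0"
proof -
  let ?n = "cdim TYPE('l)"
  let ?u = "single {..<?n} x"
  have top: "{I. I \<in> indices TYPE('l) ?n} = {{..<?n}}"
    by (auto simp: indices_def) (metis card_lessThan card_subset_eq finite_lessThan subsetD lessThan_iff)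
  have u: "?u \<in> chains TYPE('l) ?n (cvec.span {x})"
    using top by (intro single_in_chains cvec.subspace_span cvec.span_base) auto
  have derivation: "derivation l ?u = 0" for l :: 'l
  proof -
    have "derivation l ?u \<in> chains TYPE('l) ?n (cvec.span {x})"
      by (rule derivation_chains[OF cvec.subspace_span u])
    then have "derivation l ?u {..<?n} \<in> cvec.span {x}" "\<And>I. I \<noteq> {..<?n} \<Longrightarrow> derivation l ?u I = 0"
      using top by (auto simp: chains_def split: if_splits)
    moreover obtain c where "derivation l ?u {..<?n} = c *\<^sub>C x"
      using calculation(1) by (auto simp: cvec.span_singleton)
    ultimately have c: "derivation l ?u = c *\<^sub>C ?u"
      by (auto simp: fun_eq_iff single_def)
    have power: "(derivation l ^^ N) ?u = c ^ N *\<^sub>C ?u" for N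
      by (induction N) (simp_all add: cpair.linear_scale[OF clinear_derivation] c mult.commute del: scaleC_fun_apply)
    obtain N where "(derivation l ^^ N) ?u = 0"
      using derivation_nilpotent[OF fdL nilL u] by blast
    then have "c ^ N *\<^sub>C ?u = 0" using power by simp
    then have "c *\<^sub>C ?u = 0" by (auto simp: cvec.scale_eq_0_iff)
    then show ?thesis using c by simp
  qed
  have "act l ?u = 0" for l by (simp add: act_single x) (simp add: single_def fun_eq_iff)
  then have lie: "lie_derivative l ?u = 0" for l by (simp add: lie_derivative_def derivation)
  have "wedge l ?u = 0" for l :: 'l
  proof -
    have "wedge l ?u \<in> chains TYPE('l) (Suc ?n) UNIV"
      using u by (intro wedge_chains cvec.subspace_UNIV) (auto simp: chains_def)
    moreover have "indices TYPE('l) (Suc ?n) = {}"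
      by (auto simp: indices_def dest!: card_mono[OF finite_lessThan])
    ultimately show ?thesis by (auto simp: chains_def fun_eq_iff)
  qed
  then have wedge0: "wedge l (koszul ?u) = 0" for l :: 'l
    using cartan_formula[of l ?u] lie[of l] by (simp add: cpair.linear_0[OF clinear_koszul])
  show ?thesis
  proof (cases ?n)
    case 0
    then show ?thesis using u koszul_chains_0 by metis
  next
    case (Suc q)
    have u': "?u \<in> chains TYPE('l) (Suc q) UNIV" using u Suc by (auto simp: chains_def)
    have k: "koszul ?u \<in> chains TYPE('l) q UNIV"
      by (rule koszul_chains[OF submodule_UNIV u'])
    show ?thesis
    proof (rule ext)
      fix I
      show "koszul ?u I = 0 I"
      proof (cases "I \<in> indices TYPE('l) q")
        case True
        then have "card I \<noteq> card {..<?n}" using Suc by (simp add: indices_def)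
        then have "I \<noteq> {..<?n}" by blast
        then obtain a where a: "a < ?n" "a \<notin> I" using True by (auto simp: indices_def)
        have "creation a (koszul ?u) = 0"
          using wedge0[of "lie_basis a"] wedge_lie_basis[OF fdL a(1), of "koszul ?u"] by simp
        then have "creation a (koszul ?u) (insert a I) = 0" by simp
        then have "wsign a (insert a I) *\<^sub>C koszul ?u I = 0" using a by (simp add: creation_def)
        moreover have "wsign a (insert a I) \<noteq> 0" by (simp add: wsign_def)
        ultimately show ?thesis by simp
      next
        case False
        then show ?thesis using k by (auto simp: chains_def)
      qed
    qed
  qed
qed

text \<open>
  The range in degree \<open>0\<close> is contained in \<open>\<rho>(L) X\<close>: the bracket term has no component there.
\<close>

lemma koszul_bottom: "koszul u {} \<in> cvec.span {\<rho> l x | l x. x \<in> UNIV}"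
proof -
  have "wedge l v {} = 0" for l :: 'l and v :: "nat set \<Rightarrow> 'x"
    by (simp add: wedge_def sum_fun_apply creation_def)
  then have "koszul u {} = (\<Sum>i<cdim TYPE('l). \<rho> (lie_basis i) (annihilation i u {}))"
    by (simp add: koszul_def sum_fun_apply act_def fun_diff_def)
  also have "\<dots> \<in> cvec.span {\<rho> l x | l x. x \<in> UNIV}"
    by (intro cvec.span_sum cvec.span_base) auto
  finally show ?thesis .
qed

end

section \<open>The prescribed formula for the differential\<close>

text \<open>
  Deleting positions from the increasing enumeration of \<open>I\<close> gives the increasing enumeration of what
  remains. This and the next lemmas translate between positions in a list and elements of \<open>I\<close>.
\<close>

lemma sorted_list_nths:
  assumes "finite I"
  shows "nths (sorted_list_of_set I) (- S) =
    sorted_list_of_set (I - (\<lambda>k. sorted_list_of_set I ! k) ` (S \<inter> {..<card I}))"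
proof -
  let ?xs = "sorted_list_of_set I"
  have "set (nths ?xs (- S)) = I - (!) ?xs ` (S \<inter> {..<card I})"
  proof -
    have I: "I = (!) ?xs ` {..<card I}"
      using assms set_conv_nth[of ?xs] by auto
    have "inj_on ((!) ?xs) {..<card I}"
      by (intro inj_on_nth) auto
    then have "(!) ?xs ` {..<card I} - (!) ?xs ` (S \<inter> {..<card I}) = (!) ?xs ` ({..<card I} - S)"
      by (subst inj_on_image_set_diff[symmetric, where C = "{..<card I}"]) auto
    moreover have "set (nths ?xs (- S)) = (!) ?xs ` ({..<card I} - S)"
      by (auto simp: set_nths)
    ultimately show ?thesis using I by metis
  qed
  then show ?thesis
    using assms by (intro sorted_distinct_set_unique sorted_nths distinct_nthsI) auto
qed

lemma sorted_list_delete: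
  assumes "finite I" "b < card I"
  shows "sorted_list_of_set (I - {sorted_list_of_set I ! b}) =
    take b (sorted_list_of_set I) @ drop (Suc b) (sorted_list_of_set I)"
proof -
  let ?xs = "sorted_list_of_set I"
  have split: "?xs = take b ?xs @ ?xs ! b # drop (Suc b) ?xs"
    using assms by (intro id_take_nth_drop) simp
  have s: "sorted (take b ?xs @ ?xs ! b # drop (Suc b) ?xs)" and d: "distinct (take b ?xs @ ?xs ! b # drop (Suc b) ?xs)"
    unfolding split[symmetric] by simp_all
  have "I = set (take b ?xs @ ?xs ! b # drop (Suc b) ?xs)" using assms split by (metis set_sorted_list_of_set)
  then have "I - {?xs ! b} = set (take b ?xs @ drop (Suc b) ?xs)" using d by auto
  then show ?thesis
    using s d assms by (intro sorted_distinct_set_unique) (auto simp: sorted_append)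
qed

lemma sum_sorted_list:
  assumes "finite I"
  shows "(\<Sum>k<card I. F (sorted_list_of_set I ! k)) = (\<Sum>i\<in>I. F i)"
  using assms by (intro sum.reindex_bij_betw bij_betw_nth) auto

lemma below_sorted_list:
  assumes "finite I" "j < card I"
  shows "bij_betw ((!) (sorted_list_of_set I)) {..<j} {a \<in> I. a < sorted_list_of_set I ! j}"
proof -
  let ?xs = "sorted_list_of_set I"
  have mono: "?xs ! i < ?xs ! k \<longleftrightarrow> i < k" if "i < card I" "k < card I" for i k
    using that sorted_wrt_nth_less[OF strict_sorted_list_of_set[of I], of i k]
      sorted_wrt_nth_less[OF strict_sorted_list_of_set[of I], of k i]
    by (cases i k rule: linorder_cases) auto
  have "inj_on ((!) ?xs) {..<j}" using assms by (intro inj_on_nth) auto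
  moreover have "(!) ?xs ` {..<j} = {a \<in> I. a < ?xs ! j}"
  proof
    show "(!) ?xs ` {..<j} \<subseteq> {a \<in> I. a < ?xs ! j}"
      using assms mono nth_mem[of _ ?xs] by auto
    show "{a \<in> I. a < ?xs ! j} \<subseteq> (!) ?xs ` {..<j}"
    proof clarsimp
      fix a assume a: "a \<in> I" "a < ?xs ! j"
      then obtain i where "i < card I" "a = ?xs ! i"
        using assms by (metis in_set_conv_nth set_sorted_list_of_set length_sorted_list_of_set)
      then show "a \<in> (!) ?xs ` {..<j}" using a mono[of i j] assms by auto
    qed
  qed
  ultimately show ?thesis by (simp add: bij_betw_def)
qed

lemma wsign_sorted_list:
  assumes "finite I" "j < card I"
  shows "wsign (sorted_list_of_set I ! j) I = (-1) ^ j"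
  using bij_betw_same_card[OF below_sorted_list[OF assms]] by (simp add: wsign_def)

text \<open>
  Minors of the identity matrix: if \<open>J\<close> and \<open>K\<close> are different sets of the same size, some row of the
  submatrix vanishes.
\<close>

lemma det_minor:
  assumes fd: "finite_dimensional TYPE('l::complex_lie_algebra)"
    and J: "J \<in> indices TYPE('l) p" and K: "K \<in> indices TYPE('l) p"
  shows "Determinant.det (mat p p (\<lambda>(a, b).
      coord (lie_basis (sorted_list_of_set J ! a) :: 'l) (sorted_list_of_set K ! b))) = (if J = K then 1 else 0)"
proof -
  have fin: "finite J" "finite K" and card: "card J = p" "card K = p"
    and less: "\<And>j. j \<in> J \<Longrightarrow> j < cdim TYPE('l)" "\<And>k. k \<in> K \<Longrightarrow> k < cdim TYPE('l)"
    using J K by (auto simp: indices_def intro: finite_subset)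
  let ?M = "mat p p (\<lambda>(a, b). coord (lie_basis (sorted_list_of_set J ! a) :: 'l) (sorted_list_of_set K ! b))"
  have mem: "sorted_list_of_set J ! a \<in> J" "sorted_list_of_set K ! a \<in> K" if "a < p" for a
    using that fin card nth_mem[of a "sorted_list_of_set J"] nth_mem[of a "sorted_list_of_set K"] by simp_all
  have M: "?M $$ (a, b) = (if sorted_list_of_set J ! a = sorted_list_of_set K ! b then 1 else 0)"
    if "a < p" "b < p" for a b
    using that mem less by (simp add: coord_lie_basis[OF fd])
  show ?thesis
  proof (cases "J = K")
    case True
    have "?M = 1\<^sub>m p"
    proof (rule eq_matI)
      fix a b assume "a < dim_row (1\<^sub>m p)" "b < dim_col (1\<^sub>m p)"
      then have ab: "a < p" "b < p" by simp_all
      then have "(sorted_list_of_set J ! a = sorted_list_of_set J ! b) = (a = b)"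
        using card by (intro nth_eq_iff_index_eq) auto
      then show "?M $$ (a, b) = 1\<^sub>m p $$ (a, b)" using M[OF ab] ab True by simp
    qed auto
    then show ?thesis using True by simp
  next
    case False
    then obtain j where j: "j \<in> J" "j \<notin> K"
      using card_subset_eq[OF fin(2), of J] card by auto
    then obtain a where a: "a < p" "j = sorted_list_of_set J ! a"
      using fin card by (metis in_set_conv_nth set_sorted_list_of_set length_sorted_list_of_set)
    have "?M $$ (a, b) = 0" if "b < p" for b
      using M[OF a(1) that] mem(2)[OF that] j a(2) by auto
    then have "Determinant.det ?M = 0"
      using laplace_expansion_row[of ?M p a] a(1) by simp
    then show ?thesis using False by simp
  qed
qed

lemma length_sorted_indices: "I \<in> indices TYPE('l::complex_lie_algebra) p \<Longrightarrow> length (sorted_list_of_set I) = p"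
  by (auto simp: indices_def)

lemma tensor_wedge_basis:
  assumes fd: "finite_dimensional TYPE('l::complex_lie_algebra)" and J: "J \<in> indices TYPE('l) p"
  shows "tensor_wedge x (map (lie_basis :: nat \<Rightarrow> 'l) (sorted_list_of_set J)) = single J x"
proof (rule ext)
  fix I
  have len: "length (map (lie_basis :: nat \<Rightarrow> 'l) (sorted_list_of_set J)) = p"
    using J by (simp add: indices_def)
  have eq: "mat p p (\<lambda>(a, b). coord (map lie_basis (sorted_list_of_set J) ! a :: 'l) (sorted_list_of_set I ! b)) =
      mat p p (\<lambda>(a, b). coord (lie_basis (sorted_list_of_set J ! a) :: 'l) (sorted_list_of_set I ! b))"
    using length_sorted_indices[OF J] by (intro cong_mat) auto
  show "tensor_wedge x (map (lie_basis :: nat \<Rightarrow> 'l) (sorted_list_of_set J)) I = single J x I"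
  proof (cases "I \<in> indices TYPE('l) p")
    case True
    then show ?thesis
      using det_minor[OF fd J True] by (simp add: tensor_wedge_def len eq single_def scaleC_one del: length_map)
  next
    case False
    then show ?thesis using J by (auto simp: tensor_wedge_def len single_def simp del: length_map)
  qed
qed

text \<open>
  Laplace expansion along the first row is exterior multiplication by \<open>l\<close>.
\<close>

lemma tensor_wedge_Cons:
  assumes fd: "finite_dimensional TYPE('l::complex_lie_algebra)" and J: "J \<in> indices TYPE('l) p"
  shows "tensor_wedge x (l # map (lie_basis :: nat \<Rightarrow> 'l) (sorted_list_of_set J)) = wedge l (single J x)"
proof (rule ext)
  fix I
  let ?ls = "l # map (lie_basis :: nat \<Rightarrow> 'l) (sorted_list_of_set J)"
  have len: "length ?ls = Suc p" using J by (simp add: indices_def)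
  show "tensor_wedge x ?ls I = wedge l (single J x) I"
  proof (cases "I \<in> indices TYPE('l) (Suc p)")
    case False
    have "single J x \<in> chains TYPE('l) p UNIV"
      by (rule single_in_chains[OF J]) (auto simp: cvec.subspace_UNIV)
    then have "wedge l (single J x) \<in> chains TYPE('l) (Suc p) UNIV"
      by (rule wedge_chains[OF cvec.subspace_UNIV])
    then have "wedge l (single J x) I = 0" using False by (simp add: chains_def)
    moreover have "tensor_wedge x ?ls I = 0" unfolding tensor_wedge_def len using False by simp
    ultimately show ?thesis by simp
  next
    case True
    let ?xs = "sorted_list_of_set I"
    let ?M = "mat (Suc p) (Suc p) (\<lambda>(a, b). coord (?ls ! a) (?xs ! b))"
    have fin: "finite I" and card: "card I = Suc p" and sub: "I \<subseteq> {..<cdim TYPE('l)}"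
      using True by (auto simp: indices_def intro: finite_subset)
    have minor: "Determinant.det (mat_delete ?M 0 b) = (if J = I - {?xs ! b} then 1 else 0)" if b: "b < Suc p" for b
    proof -
      have "?xs ! b \<in> I" using b fin card nth_mem[of b ?xs] by simp
      then have I': "I - {?xs ! b} \<in> indices TYPE('l) p" using sub fin card by (auto simp: indices_def)
      have nth: "sorted_list_of_set (I - {?xs ! b}) ! c = ?xs ! (if c < b then c else Suc c)" if "c < p" for c
        using that b card fin by (simp add: sorted_list_delete nth_append min_def)
      have "mat_delete ?M 0 b = mat p p (\<lambda>(a, c). coord (lie_basis (sorted_list_of_set J ! a) :: 'l)
          (sorted_list_of_set (I - {?xs ! b}) ! c))"
        unfolding mat_delete_def using length_sorted_indices[OF J] b nth
        by (intro eq_matI) auto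
      then show ?thesis using det_minor[OF fd J I'] by simp
    qed
    have "Determinant.det ?M = (\<Sum>b<Suc p. ?M $$ (0, b) * cofactor ?M 0 b)"
      by (rule laplace_expansion_row) auto
    also have "\<dots> = (\<Sum>b<Suc p. coord l (?xs ! b) * (wsign (?xs ! b) I * (if J = I - {?xs ! b} then 1 else 0)))"
      using fin card by (intro sum.cong) (auto simp: cofactor_def minor wsign_sorted_list simp del: sum.lessThan_Suc)
    also have "\<dots> = (\<Sum>i\<in>I. coord l i * (wsign i I * (if J = I - {i} then 1 else 0)))"
      using sum_sorted_list[OF fin, of "\<lambda>i. coord l i * (wsign i I * (if J = I - {i} then 1 else 0))"] card by simp
    finally have "tensor_wedge x ?ls I =
        (\<Sum>i\<in>I. coord l i * (wsign i I * (if J = I - {i} then 1 else 0))) *\<^sub>C x"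
      using True by (simp only: tensor_wedge_def len if_True)
    also have "\<dots> = (\<Sum>i\<in>I. coord l i *\<^sub>C creation i (single J x) I)"
      unfolding cvec.scale_sum_left
      by (intro sum.cong) (auto simp: creation_def single_def scaleC_scaleC)
    also have "\<dots> = (\<Sum>i<cdim TYPE('l). coord l i *\<^sub>C creation i (single J x) I)"
      using sub by (intro sum.mono_neutral_left) (auto simp: creation_def)
    finally show ?thesis by (simp add: wedge_def sum_fun_apply)
  qed
qed

lemma annihilation_single:
  "annihilation i (single I x) = (if i \<in> I then wsign i I *\<^sub>C single (I - {i}) x else 0)"
proof (rule ext)
  fix J
  have "insert i J = I \<longleftrightarrow> J = I - {i}" if "i \<in> I" "i \<notin> J" using that by auto
  then show "annihilation i (single I x) J = (if i \<in> I then wsign i I *\<^sub>C single (I - {i}) x else 0) J"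
    by (auto simp: annihilation_def single_def wsign_insert insert_absorb wsign_remove)
qed

lemma (in nilpotent_lie_module) koszul_single:
  assumes I: "I \<in> indices TYPE('l) p"
  shows "koszul (single I x) =
    (\<Sum>i\<in>I. wsign i I *\<^sub>C single (I - {i}) (\<rho> (lie_basis i) x)) -
    (\<Sum>b\<in>I. \<Sum>a\<in>{a \<in> I. a < b}. (wsign a I * wsign b I) *\<^sub>C
       wedge (bracket (lie_basis a) (lie_basis b :: 'l)) (single (I - {a, b}) x))"
proof -
  have sub: "I \<subseteq> {..<cdim TYPE('l)}" using I by (simp add: indices_def)
  have "(\<Sum>i<cdim TYPE('l). act (lie_basis i) (annihilation i (single I x))) =
      (\<Sum>i\<in>I. act (lie_basis i) (annihilation i (single I x)))"
    using sub by (intro sum.mono_neutral_right) (auto simp: annihilation_single cpair.linear_0[OF clinear_act])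
  also have "\<dots> = (\<Sum>i\<in>I. wsign i I *\<^sub>C single (I - {i}) (\<rho> (lie_basis i) x))"
    by (intro sum.cong) (simp_all add: annihilation_single cpair.linear_scale[OF clinear_act] act_single)
  finally have A: "(\<Sum>i<cdim TYPE('l). act (lie_basis i) (annihilation i (single I x))) = \<dots>" .
  let ?W = "\<lambda>a b. wedge (bracket (lie_basis a) (lie_basis b :: 'l)) (annihilation a (annihilation b (single I x)))"
  have W: "?W a b = (if a \<in> I \<and> b \<in> I then (wsign a I * wsign b I) *\<^sub>C
       wedge (bracket (lie_basis a) (lie_basis b :: 'l)) (single (I - {a, b}) x) else 0)" if "a < b" for a b
  proof (cases "a \<in> I \<and> b \<in> I")
    case True
    moreover have "I - {b} - {a} = I - {a, b}" by auto
    ultimately show ?thesis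
      using that by (simp add: annihilation_single cpair.linear_scale[OF clinear_annihilation]
        cpair.linear_scale[OF clinear_wedge] wsign_remove mult.commute)
  next
    case False
    then show ?thesis using that
      by (auto simp: annihilation_single cpair.linear_scale[OF clinear_annihilation]
        cpair.linear_0[OF clinear_wedge] cpair.linear_0[OF clinear_annihilation])
  qed
  have "(\<Sum>b<cdim TYPE('l). \<Sum>a<b. ?W a b) = (\<Sum>b\<in>I. \<Sum>a<b. ?W a b)"
    using sub by (intro sum.mono_neutral_right) (auto simp: W intro!: sum.neutral)
  also have "\<dots> = (\<Sum>b\<in>I. \<Sum>a\<in>{a \<in> I. a < b}. ?W a b)"
    by (intro sum.cong refl sum.mono_neutral_right) (auto simp: W)
  also have "\<dots> = (\<Sum>b\<in>I. \<Sum>a\<in>{a \<in> I. a < b}. (wsign a I * wsign b I) *\<^sub>C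
       wedge (bracket (lie_basis a) (lie_basis b :: 'l)) (single (I - {a, b}) x))"
    by (intro sum.cong refl) (simp add: W)
  finally show ?thesis unfolding koszul_def A by simp
qed

lemma koszul_formula_eq:
  fixes \<rho> :: "'l::complex_lie_algebra \<Rightarrow> 'x::complex_banach \<Rightarrow> 'x"
  assumes "nilpotent_lie_module \<rho>" and I: "I \<in> indices TYPE('l) p"
  shows "koszul_formula \<rho> x (map lie_basis (sorted_list_of_set I)) = lie_module.koszul \<rho> (single I x)"
proof -
  interpret nilpotent_lie_module \<rho> by fact
  let ?xs = "sorted_list_of_set I" and ?e = "lie_basis :: nat \<Rightarrow> 'l"
  have fin: "finite I" and card: "card I = p" and sub: "I \<subseteq> {..<cdim TYPE('l)}"
    using I by (auto simp: indices_def intro: finite_subset)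
  have xs: "?xs ! k \<in> I" if "k < p" for k using nth_mem[of k ?xs] that fin card by simp
  have del: "I - S \<in> indices TYPE('l) (card (I - S))" for S using sub by (auto simp: indices_def)
  have 1: "(-1) ^ k *\<^sub>C tensor_wedge (\<rho> (map ?e ?xs ! k) x) (nths (map ?e ?xs) (- {k})) =
      wsign (?xs ! k) I *\<^sub>C single (I - {?xs ! k}) (\<rho> (?e (?xs ! k)) x)" if "k < p" for k
  proof -
    have "nths (map ?e ?xs) (- {k}) = map ?e (sorted_list_of_set (I - {?xs ! k}))"
      using that card by (simp add: nths_map sorted_list_nths[OF fin])
    then show ?thesis
      using that card fin by (simp add: tensor_wedge_basis[OF fdL del] wsign_sorted_list)
  qed
  have 2: "(-1) ^ (i + j + 1) *\<^sub>C tensor_wedge x (bracket (map ?e ?xs ! i) (map ?e ?xs ! j) # nths (map ?e ?xs) (- {i, j})) =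
      - ((wsign (?xs ! i) I * wsign (?xs ! j) I) *\<^sub>C
        wedge (bracket (?e (?xs ! i)) (?e (?xs ! j))) (single (I - {?xs ! i, ?xs ! j}) x))"
    if "i < j" "j < p" for i j
  proof -
    have "nths (map ?e ?xs) (- {i, j}) = map ?e (sorted_list_of_set (I - {?xs ! i, ?xs ! j}))"
      using that card by (simp add: nths_map sorted_list_nths[OF fin])
    then show ?thesis
      using that card fin by (simp add: tensor_wedge_Cons[OF fdL del] wsign_sorted_list power_add)
  qed
  have "koszul_formula \<rho> x (map ?e ?xs) =
      (\<Sum>k<p. (-1) ^ k *\<^sub>C tensor_wedge (\<rho> (map ?e ?xs ! k) x) (nths (map ?e ?xs) (- {k}))) +
      (\<Sum>j<p. \<Sum>i<j. (-1) ^ (i + j + 1) *\<^sub>C tensor_wedge x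
         (bracket (map ?e ?xs ! i) (map ?e ?xs ! j) # nths (map ?e ?xs) (- {i, j})))"
    using card fin by (simp add: koszul_formula_def fun_eq_iff sum_fun_apply)
  also have "(\<Sum>k<p. (-1) ^ k *\<^sub>C tensor_wedge (\<rho> (map ?e ?xs ! k) x) (nths (map ?e ?xs) (- {k}))) =
      (\<Sum>k<card I. wsign (?xs ! k) I *\<^sub>C single (I - {?xs ! k}) (\<rho> (?e (?xs ! k)) x))"
    unfolding card by (intro sum.cong refl 1) simp
  also have "\<dots> = (\<Sum>i\<in>I. wsign i I *\<^sub>C single (I - {i}) (\<rho> (?e i) x))"
    by (rule sum_sorted_list[OF fin])
  also have "(\<Sum>j<p. \<Sum>i<j. (-1) ^ (i + j + 1) *\<^sub>C tensor_wedge x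
         (bracket (map ?e ?xs ! i) (map ?e ?xs ! j) # nths (map ?e ?xs) (- {i, j}))) =
      (\<Sum>j<card I. \<Sum>i<j. - ((wsign (?xs ! i) I * wsign (?xs ! j) I) *\<^sub>C
        wedge (bracket (?e (?xs ! i)) (?e (?xs ! j))) (single (I - {?xs ! i, ?xs ! j}) x)))"
    unfolding card by (intro sum.cong refl 2) auto
  also have "\<dots> = (\<Sum>j<card I. \<Sum>a\<in>{a \<in> I. a < ?xs ! j}. - ((wsign a I * wsign (?xs ! j) I) *\<^sub>C
        wedge (bracket (?e a) (?e (?xs ! j))) (single (I - {a, ?xs ! j}) x)))"
    by (intro sum.cong refl sum.reindex_bij_betw below_sorted_list fin) simp
  also have "\<dots> = (\<Sum>b\<in>I. \<Sum>a\<in>{a \<in> I. a < b}. - ((wsign a I * wsign b I) *\<^sub>C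
        wedge (bracket (?e a) (?e b)) (single (I - {a, b}) x)))"
    by (rule sum_sorted_list[OF fin])
  finally show ?thesis
    unfolding koszul_single[OF I] by (simp only: sum_negf diff_conv_add_uminus)
qed

lemma koszul_space_eq: "koszul_space TYPE('l::complex_lie_algebra) p = chains TYPE('l) p UNIV"
  by (auto simp: koszul_space_def chains_def)

text \<open>
  The differential defined by its values on the basis is the operator \<open>koszul\<close>; in degree \<open>0\<close> and in
  degrees above \<open>n\<close> both vanish on chains.
\<close>

lemma koszul_d_eq:
  fixes \<rho> :: "'l::complex_lie_algebra \<Rightarrow> 'x::complex_banach \<Rightarrow> 'x"
  assumes "nilpotent_lie_module \<rho>" and u: "u \<in> koszul_space TYPE('l) p"
  shows "koszul_d \<rho> p u = lie_module.koszul \<rho> u"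
proof -
  interpret nilpotent_lie_module \<rho> by fact
  have u': "u \<in> chains TYPE('l) p UNIV" using u by (simp add: koszul_space_eq)
  consider "p = 0" | "p > cdim TYPE('l)" | "1 \<le> p" "p \<le> cdim TYPE('l)" by linarith
  then show ?thesis
  proof cases
    case 1
    then show ?thesis using u' koszul_chains_0 by (auto simp: koszul_d_def zero_fun_def)
  next
    case 2
    then have "indices TYPE('l) p = {}"
      by (auto simp: indices_def dest!: card_mono[OF finite_lessThan])
    then have "u = 0" using u' by (auto simp: chains_def)
    then show ?thesis using 2 by (simp add: koszul_d_def cpair.linear_0[OF clinear_koszul]) (simp add: zero_fun_def)
  next
    case 3
    have "koszul_d \<rho> p u = (\<Sum>I\<in>indices TYPE('l) p. koszul (single I (u I)))"
      using 3 by (auto simp: koszul_d_def sum_fun_apply fun_eq_iff koszul_formula_eq[OF assms(1)] intro!: sum.cong)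
    also have "\<dots> = koszul (\<Sum>I\<in>indices TYPE('l) p. single I (u I))"
      by (rule cpair.linear_sum[OF clinear_koszul, symmetric])
    also have "(\<Sum>I\<in>indices TYPE('l) p. single I (u I)) = u"
      by (rule chains_sum_single[OF u', symmetric])
    finally show ?thesis .
  qed
qed

section \<open>Closed subspaces\<close>

lemma tendsto_scaleC_left:
  fixes b :: "'x::complex_banach"
  assumes "a \<longlonglongrightarrow> c"
  shows "(\<lambda>n. a n *\<^sub>C b) \<longlonglongrightarrow> c *\<^sub>C b"
proof -
  have "(\<lambda>n. cmod (a n - c) * norm b) \<longlonglongrightarrow> 0"
    using assms by (intro tendsto_mult_left_zero) (simp add: LIM_zero tendsto_norm_zero)
  moreover have "norm (a n *\<^sub>C b - c *\<^sub>C b) = cmod (a n - c) * norm b" for n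
    by (simp add: norm_scaleC flip: cvec.scale_left_diff_distrib)
  ultimately have "(\<lambda>n. norm (a n *\<^sub>C b - c *\<^sub>C b)) \<longlonglongrightarrow> 0" by (simp only:)
  then show ?thesis by (rule LIM_zero_cancel[OF tendsto_norm_zero_cancel])
qed

text \<open>
  A closed subspace has positive distance from any vector outside it, so the coefficient of that
  vector is a bounded function of the sum. This drives both the closedness of spans and the
  continuity of functionals below.
\<close>

lemma coefficient_bound:
  fixes V :: "'x::complex_banach set"
  assumes "cvec.subspace V" "closed V" "b \<notin> V"
  obtains \<delta> where "\<delta> > 0" "\<And>v a. v \<in> V \<Longrightarrow> cmod a * \<delta> \<le> norm (v + a *\<^sub>C b)"
proof -
  obtain \<delta> where \<delta>: "\<delta> > 0" "ball b \<delta> \<subseteq> - V"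
    using assms(2,3) open_contains_ball[of "- V"] by (auto simp: open_Compl)
  have "cmod a * \<delta> \<le> norm (v + a *\<^sub>C b)" if v: "v \<in> V" for v a
  proof (cases "a = 0")
    case False
    have "(- (1 / a)) *\<^sub>C v \<in> V" using assms(1) v by (rule cvec.subspace_scale)
    then have "\<delta> \<le> norm (b - (- (1 / a)) *\<^sub>C v)" using \<delta>(2) by (force simp: dist_norm not_less[symmetric])
    then have "cmod a * \<delta> \<le> norm (a *\<^sub>C (b - (- (1 / a)) *\<^sub>C v))"
      by (simp add: norm_scaleC mult_left_mono)
    also have "a *\<^sub>C (b - (- (1 / a)) *\<^sub>C v) = v + a *\<^sub>C b"
      using False by (simp add: cvec.scale_right_diff_distrib scaleC_add_right scaleC_scaleC scaleC_one add.commute)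
    finally show ?thesis .
  qed simp
  then show ?thesis using that \<delta>(1) by blast
qed

text \<open>
  When \<open>b\<close> is added to a closed span, the coefficients of \<open>b\<close> in a convergent sequence form a Cauchy
  sequence by the preceding bound, so they converge and the remaining components converge too.
\<close>

lemma closed_span_finite:
  fixes B :: "'x::complex_banach set"
  assumes "finite B"
  shows "closed (cvec.span B)"
  using assms
proof (induction B)
  case (insert b B)
  show ?case
  proof (cases "b \<in> cvec.span B")
    case True
    then show ?thesis using insert.IH by (simp add: cvec.span_redundant)
  next
    case False
    let ?V = "cvec.span B"
    obtain \<delta> where \<delta>: "\<delta> > 0" "\<And>v a. v \<in> ?V \<Longrightarrow> cmod a * \<delta> \<le> norm (v + a *\<^sub>C b)"
      using coefficient_bound[OF cvec.subspace_span insert.IH False] by blast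
    show ?thesis
      unfolding closed_sequential_limits
    proof (intro allI impI, elim conjE)
      fix x l assume x: "\<forall>n. x n \<in> cvec.span (insert b B)" and l: "x \<longlonglongrightarrow> l"
      have "\<forall>n. \<exists>a. x n - a *\<^sub>C b \<in> ?V"
        using x by (auto simp: cvec.span_insert)
      then obtain a where a: "\<And>n. x n - a n *\<^sub>C b \<in> ?V" by metis
      have bound: "cmod (a m - a n) * \<delta> \<le> norm (x m - x n)" for m n
      proof -
        have "(x m - a m *\<^sub>C b) - (x n - a n *\<^sub>C b) \<in> ?V"
          by (intro cvec.span_diff a)
        from \<delta>(2)[OF this, of "a m - a n"] show ?thesis
          by (simp add: cvec.scale_left_diff_distrib algebra_simps)
      qed
      have "Cauchy a"
      proof (rule metric_CauchyI)
        fix e :: real assume "e > 0"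
        then have "e * \<delta> > 0" using \<delta>(1) by simp
        then obtain M where M: "\<And>m n. m \<ge> M \<Longrightarrow> n \<ge> M \<Longrightarrow> dist (x m) (x n) < e * \<delta>"
          using metric_CauchyD[OF LIMSEQ_imp_Cauchy[OF l]] by blast
        have "dist (a m) (a n) < e" if "m \<ge> M" "n \<ge> M" for m n
        proof -
          have "cmod (a m - a n) * \<delta> < e * \<delta>"
            using bound[of m n] M[OF that] by (simp add: dist_norm)
          then show ?thesis using \<delta>(1) by (simp add: dist_norm)
        qed
        then show "\<exists>M. \<forall>m\<ge>M. \<forall>n\<ge>M. dist (a m) (a n) < e" by blast
      qed
      then obtain c where "a \<longlonglongrightarrow> c" using Cauchy_convergent convergent_def by blast
      then have "(\<lambda>n. x n - a n *\<^sub>C b) \<longlonglongrightarrow> l - c *\<^sub>C b"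
        by (intro tendsto_diff l tendsto_scaleC_left)
      then have "l - c *\<^sub>C b \<in> ?V"
        by (rule closed_sequentially[OF insert.IH, rotated]) (rule a)
      then show "l \<in> cvec.span (insert b B)" by (auto simp: cvec.span_insert)
    qed
  qed
qed simp

interpretation functional: vector_space_pair
  "scaleC :: complex \<Rightarrow> 'a \<Rightarrow> 'a::complex_vector" "(*) :: complex \<Rightarrow> complex \<Rightarrow> complex"
  by unfold_locales (simp_all add: algebra_simps)

lemma closed_subspace_finite_dimensional:
  fixes V :: "'x::complex_banach set"
  assumes "finite_dimensional TYPE('x)" "cvec.subspace V"
  shows "closed V"
proof -
  obtain B :: "'x set" where "finite_dimensional_vector_space scaleC B"
    using assms(1) by (rule finite_dimensional_basis)
  then interpret fd: finite_dimensional_vector_space scaleC B .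
  obtain A where A: "A \<subseteq> V" "cvec.independent A" "V \<subseteq> cvec.span A"
    using cvec.maximal_independent_subset[of V] by blast
  have "V = cvec.span A" using A cvec.span_minimal[OF A(1) assms(2)] by blast
  then show ?thesis using closed_span_finite[OF fd.finiteI_independent[OF A(2)]] by simp
qed

lemma continuous_functional:
  fixes \<phi> :: "'x::complex_banach \<Rightarrow> complex"
  assumes fd: "finite_dimensional TYPE('x)" and \<phi>: "Vector_Spaces.linear scaleC (*) \<phi>"
  shows "continuous_on UNIV \<phi>"
proof (cases "\<forall>x. \<phi> x = 0")
  case True
  then have "\<phi> = (\<lambda>_. 0)" by auto
  then show ?thesis by simp
next
  case False
  then obtain b0 where "\<phi> b0 \<noteq> 0" by blast
  define b where "b = (1 / \<phi> b0) *\<^sub>C b0"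
  have b: "\<phi> b = 1" using \<open>\<phi> b0 \<noteq> 0\<close> by (simp add: b_def functional.linear_scale[OF \<phi>])
  have ker: "cvec.subspace {x. \<phi> x = 0}"
    by (auto simp: cvec.subspace_def functional.linear_0[OF \<phi>] functional.linear_add[OF \<phi>] functional.linear_scale[OF \<phi>])
  have "b \<notin> {x. \<phi> x = 0}" using b by simp
  then obtain \<delta> where \<delta>: "\<delta> > 0" "\<And>v a. v \<in> {x. \<phi> x = 0} \<Longrightarrow> cmod a * \<delta> \<le> norm (v + a *\<^sub>C b)"
    using coefficient_bound[OF ker closed_subspace_finite_dimensional[OF fd ker]] by blast
  have "bounded_linear \<phi>"
  proof (rule bounded_linear_intro)
    show "\<phi> (x + y) = \<phi> x + \<phi> y" for x y by (rule functional.linear_add[OF \<phi>])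
    show "\<phi> (r *\<^sub>R x) = r *\<^sub>R \<phi> x" for r x
      by (simp add: scaleR_scaleC functional.linear_scale[OF \<phi>] scaleR_conv_of_real)
    show "norm (\<phi> x) \<le> norm x * (1 / \<delta>)" for x
    proof -
      have "x - \<phi> x *\<^sub>C b \<in> {x. \<phi> x = 0}"
        by (simp add: functional.linear_diff[OF \<phi>] functional.linear_scale[OF \<phi>] b)
      from \<delta>(2)[OF this, of "\<phi> x"] show ?thesis using \<delta>(1) by (simp add: field_simps)
    qed
  qed
  then show ?thesis by (rule bounded_linear.continuous_on[OF _ continuous_on_id])
qed

lemma separating_functional:
  fixes S :: "'a::complex_vector set"
  assumes "cvec.subspace S" "z \<notin> S"
  obtains \<psi> where "Vector_Spaces.linear scaleC (*) \<psi>" "\<And>s. s \<in> S \<Longrightarrow> \<psi> s = 0" "\<psi> z = (1 :: complex)"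
proof -
  obtain B where B: "B \<subseteq> S" "cvec.independent B" "S \<subseteq> cvec.span B"
    using cvec.maximal_independent_subset[of S] by blast
  have span: "cvec.span B \<subseteq> S" by (rule cvec.span_minimal[OF B(1) assms(1)])
  then have "cvec.independent (insert z B)"
    using assms(2) B(2) by (intro cvec.independent_insertI) auto
  then obtain \<psi> :: "'a \<Rightarrow> complex" where \<psi>: "Vector_Spaces.linear scaleC (*) \<psi>"
      "\<forall>x \<in> insert z B. \<psi> x = (if x = z then 1 else 0)"
    using functional.linear_independent_extend[of "insert z B" "\<lambda>x. if x = z then 1 else 0"] by blast
  have "\<psi> s = 0" if "s \<in> S" for s
  proof (rule functional.linear_eq_0_on_span[OF \<psi>(1)])
    show "s \<in> cvec.span B" using that B(3) by blast
    show "\<psi> x = 0" if "x \<in> B" for x using \<psi>(2) that assms(2) B(1) by auto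
  qed
  then show ?thesis using that \<psi> by auto
qed

text \<open>
  The chain space carries the product topology and no norm, so closedness is proved by writing
  the subspace \<open>S\<close> as the common zero set of the linear functionals that vanish on it. Such a functional is
  continuous because on chains it is a finite sum of functionals in single coordinates.
\<close>

lemma closed_subspace_chains:
  fixes S :: "(nat set \<Rightarrow> 'x::complex_banach) set"
  assumes fd: "finite_dimensional TYPE('x)" and S: "cvec.subspace S"
    and sub: "S \<subseteq> chains TYPE('l::complex_lie_algebra) p UNIV"
  shows "closed S"
proof -
  let ?C = "chains TYPE('l) p UNIV :: (nat set \<Rightarrow> 'x) set"
  define \<Psi> where "\<Psi> = {\<psi> :: (nat set \<Rightarrow> 'x) \<Rightarrow> complex. Vector_Spaces.linear scaleC (*) \<psi> \<and> (\<forall>s \<in> S. \<psi> s = 0)}"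
  let ?g = "\<lambda>\<psi> u. \<Sum>I\<in>indices TYPE('l) p. (\<psi> (single I (u I)) :: complex)"
  have g: "?g \<psi> u = \<psi> u" if "\<psi> \<in> \<Psi>" "u \<in> ?C" for \<psi> u
  proof -
    have "Vector_Spaces.linear scaleC (*) \<psi>" using that(1) by (simp add: \<Psi>_def)
    then have "\<psi> (\<Sum>I\<in>indices TYPE('l) p. single I (u I)) = ?g \<psi> u"
      by (rule functional.linear_sum)
    then show ?thesis using chains_sum_single[OF that(2)] by simp
  qed
  have cont: "continuous_on UNIV (?g \<psi>)" if "\<psi> \<in> \<Psi>" for \<psi>
  proof (intro continuous_on_sum)
    fix I
    have lin: "Vector_Spaces.linear scaleC (*) (\<lambda>x. \<psi> (single I x))"
    proof -
      have \<psi>: "Vector_Spaces.linear scaleC (*) \<psi>" using that by (simp add: \<Psi>_def)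
      have "single I (x + y) = single I x + single I y" "single I (a *\<^sub>C x) = a *\<^sub>C single I x" for x y :: 'x and a
        by (auto simp: single_def fun_eq_iff)
      moreover have "vector_space ((*) :: complex \<Rightarrow> complex \<Rightarrow> complex)"
        using \<psi> by (simp add: Vector_Spaces.linear_iff)
      ultimately show ?thesis
        by (simp add: Vector_Spaces.linear_iff cvec.vector_space_axioms
            functional.linear_add[OF \<psi>] functional.linear_scale[OF \<psi>])
    qed
    show "continuous_on UNIV (\<lambda>u. \<psi> (single I (u I)))"
      by (rule continuous_on_compose2[OF continuous_functional[OF fd lin], of UNIV "\<lambda>u. u I"]) auto
  qed
  have eq: "S = {u. \<forall>I. I \<notin> indices TYPE('l) p \<longrightarrow> u I = 0} \<inter> (\<Inter>\<psi>\<in>\<Psi>. {u. ?g \<psi> u = 0})"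
  proof (intro subset_antisym subsetI)
    fix u assume "u \<in> S"
    then show "u \<in> {u. \<forall>I. I \<notin> indices TYPE('l) p \<longrightarrow> u I = 0} \<inter> (\<Inter>\<psi>\<in>\<Psi>. {u. ?g \<psi> u = 0})"
      using sub g by (auto simp: \<Psi>_def chains_def)
  next
    fix u assume u: "u \<in> {u. \<forall>I. I \<notin> indices TYPE('l) p \<longrightarrow> u I = 0} \<inter> (\<Inter>\<psi>\<in>\<Psi>. {u. ?g \<psi> u = 0})"
    then have C: "u \<in> ?C" by (auto simp: chains_def)
    show "u \<in> S"
    proof (rule ccontr)
      assume "u \<notin> S"
      then obtain \<psi> where "Vector_Spaces.linear scaleC (*) \<psi>" "\<And>s. s \<in> S \<Longrightarrow> \<psi> s = 0" "\<psi> u = (1 :: complex)"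
        using separating_functional[OF S] by metis
      then have "\<psi> \<in> \<Psi>" "\<psi> u = 1" by (auto simp: \<Psi>_def)
      then show False using u g[OF _ C] by auto
    qed
  qed
  have 1: "closed {u :: nat set \<Rightarrow> 'x. \<forall>I. I \<notin> indices TYPE('l) p \<longrightarrow> u I = 0}"
    by (intro closed_Collect_all closed_Collect_imp closed_Collect_eq continuous_on_const) auto
  have 2: "closed (\<Inter>\<psi>\<in>\<Psi>. {u. ?g \<psi> u = 0})"
    by (intro closed_INT ballI closed_Collect_eq cont continuous_on_const)
  show ?thesis by (subst eq) (rule closed_Int[OF 1 2])
qed

section \<open>Homology and joint spectra\<close>

lemma nilpotent_lie_module_shift:
  fixes \<rho> :: "'l::complex_lie_algebra \<Rightarrow> 'x::complex_banach \<Rightarrow> 'x"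
  assumes "finite_dimensional TYPE('x)" "finite_dimensional TYPE('l)" "nilpotent TYPE('l)"
    and \<rho>: "representation \<rho>" and f: "f \<in> characters"
  shows "nilpotent_lie_module (shift \<rho> f)"
proof -
  have f: "Vector_Spaces.linear scaleC (*) f" "\<And>l m. f (bracket l m) = 0"
    using f by (auto simp: characters_def)
  have lin: "\<rho> l (x + y) = \<rho> l x + \<rho> l y" "\<rho> l (a *\<^sub>C x) = a *\<^sub>C \<rho> l x" for l x y a
    using \<rho> by (auto simp: representation_def operators_def bounded_linear.linear linear_add)
  have rep: "\<rho> (l + m) x = \<rho> l x + \<rho> m x" "\<rho> (a *\<^sub>C l) x = a *\<^sub>C \<rho> l x"
    "\<rho> (bracket l m) x = \<rho> l (\<rho> m x) - \<rho> m (\<rho> l x)" for l m x a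
    using \<rho> by (auto simp: representation_def)
  have diff: "\<rho> l (x - y) = \<rho> l x - \<rho> l y" for l x y
    using lin(1)[of l "x - y" y] by (simp add: algebra_simps)
  show ?thesis
  proof (intro nilpotent_lie_module.intro lie_module.intro nilpotent_lie_module_axioms.intro)
    show "clinear (shift \<rho> f l)" for l
      by (rule clinearI) (simp_all add: shift_def lin scaleC_add_right cvec.scale_right_diff_distrib mult.commute)
    show "clinear (\<lambda>l. shift \<rho> f l x)" for x
      by (rule clinearI) (simp_all add: shift_def rep functional.linear_add[OF f(1)] functional.linear_scale[OF f(1)]
          scaleC_add_left cvec.scale_right_diff_distrib)
    show "shift \<rho> f (bracket l m) x = shift \<rho> f l (shift \<rho> f m x) - shift \<rho> f m (shift \<rho> f l x)" for l m x
      by (simp add: shift_def rep f(2) diff lin cvec.scale_right_diff_distrib mult.commute)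
  qed fact+
qed

lemma subspace_koszul_range:
  fixes \<rho> :: "'l::complex_lie_algebra \<Rightarrow> 'x::complex_banach \<Rightarrow> 'x"
  assumes "nilpotent_lie_module \<rho>"
  shows "cvec.subspace (koszul_range \<rho> p)"
proof -
  interpret nilpotent_lie_module \<rho> by fact
  have "koszul_range \<rho> p = koszul ` chains TYPE('l) p UNIV"
    by (simp add: koszul_range_def koszul_d_eq[OF assms] koszul_space_eq cong: image_cong_simp)
  then show ?thesis
    using cpair.linear_subspace_image[OF clinear_koszul subspace_chains[OF cvec.subspace_UNIV]] by simp
qed

lemma closed_koszul_range:
  fixes \<rho> :: "'l::complex_lie_algebra \<Rightarrow> 'x::complex_banach \<Rightarrow> 'x"
  assumes "nilpotent_lie_module \<rho>"
  shows "closed (koszul_range \<rho> p)"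
proof -
  interpret nilpotent_lie_module \<rho> by fact
  have "koszul_range \<rho> p \<subseteq> chains TYPE('l) (p - 1) UNIV"
  proof (cases p)
    case 0
    then show ?thesis
      by (auto simp: koszul_range_def koszul_d_def chains_def)
  next
    case (Suc q)
    then show ?thesis
      using koszul_chains[OF submodule_UNIV] by (auto simp: koszul_range_def koszul_d_eq[OF assms] koszul_space_eq)
  qed
  then show ?thesis
    by (rule closed_subspace_chains[OF fdX subspace_koszul_range[OF assms]])
qed

lemma homology_nonzero_iff:
  fixes \<rho> :: "'l::complex_lie_algebra \<Rightarrow> 'x::complex_banach \<Rightarrow> 'x"
  assumes "nilpotent_lie_module \<rho>"
  shows "homology_nonzero \<rho> p \<longleftrightarrow>
    (\<exists>z \<in> chains TYPE('l) p UNIV. lie_module.koszul \<rho> z = 0 \<and>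
      (\<forall>w \<in> chains TYPE('l) (Suc p) UNIV. lie_module.koszul \<rho> w \<noteq> z))"
proof -
  interpret nilpotent_lie_module \<rho> by fact
  let ?B = "koszul_range \<rho> (p + 1)" and ?Z = "koszul_kernel \<rho> p"
  have B: "?B = koszul ` chains TYPE('l) (Suc p) UNIV"
    by (simp add: koszul_range_def koszul_d_eq[OF assms] koszul_space_eq cong: image_cong_simp)
  have Z: "?Z = {z \<in> chains TYPE('l) p UNIV. koszul z = 0}"
    by (auto simp: koszul_kernel_def koszul_d_eq[OF assms] koszul_space_eq zero_fun_def)
  have subB: "cvec.subspace ?B" by (rule subspace_koszul_range[OF assms])
  have coset: "{\<lambda>I. z I + b I | b. b \<in> ?B} = (+) z ` ?B" for z
    by (auto simp: image_def plus_fun_def)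
  have trivial: "(+) z ` ?B = ?B \<longleftrightarrow> z \<in> ?B" for z
  proof
    assume "(+) z ` ?B = ?B"
    moreover have "z + 0 \<in> (+) z ` ?B" using cvec.subspace_0[OF subB] by blast
    ultimately show "z \<in> ?B" by simp
  next
    assume z: "z \<in> ?B"
    show "(+) z ` ?B = ?B"
    proof
      show "(+) z ` ?B \<subseteq> ?B" using z subB by (auto intro: cvec.subspace_add)
      show "?B \<subseteq> (+) z ` ?B"
      proof
        fix b assume "b \<in> ?B"
        then have "b - z \<in> ?B" using z subB by (auto intro: cvec.subspace_diff)
        then show "b \<in> (+) z ` ?B" by (auto simp: image_def intro!: bexI[of _ "b - z"])
      qed
    qed
  qed
  have "0 \<in> ?Z"
    unfolding Z using cvec.subspace_0[OF subspace_chains[OF cvec.subspace_UNIV]]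
    by (simp add: cpair.linear_0[OF clinear_koszul])
  then have "?B \<in> (\<lambda>z. (+) z ` ?B) ` ?Z"
    by (intro image_eqI[of _ _ 0]) (simp_all add: trivial cvec.subspace_0[OF subB])
  moreover have "(f ` A = {c}) = (\<forall>a \<in> A. f a = c)" if "c \<in> f ` A"
    for f :: "(nat set \<Rightarrow> 'x) \<Rightarrow> (nat set \<Rightarrow> 'x) set" and A c
    using that by auto
  moreover have "koszul_homology \<rho> p = (\<lambda>z. (+) z ` ?B) ` ?Z"
    unfolding koszul_homology_def coset by (rule Setcompr_eq_image)
  ultimately have "koszul_homology \<rho> p = {?B} \<longleftrightarrow> (\<forall>z \<in> ?Z. (+) z ` ?B = ?B)"
    by (simp only:)
  then have "koszul_homology \<rho> p \<noteq> {?B} \<longleftrightarrow> (\<exists>z \<in> ?Z. z \<notin> ?B)"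
    by (simp only: trivial) blast
  then show ?thesis unfolding homology_nonzero_def B Z by auto
qed

lemma homology_nonzero_imp_invariant:
  fixes \<rho> :: "'l::complex_lie_algebra \<Rightarrow> 'x::complex_banach \<Rightarrow> 'x"
  assumes "nilpotent_lie_module \<rho>" "homology_nonzero \<rho> p"
  shows "\<exists>x. x \<noteq> 0 \<and> (\<forall>l. \<rho> l x = 0)"
proof -
  interpret nilpotent_lie_module \<rho> by fact
  obtain z where z: "z \<in> chains TYPE('l) p UNIV" "koszul z = 0"
      and not_range: "\<And>w. w \<in> chains TYPE('l) (Suc p) UNIV \<Longrightarrow> koszul w \<noteq> z"
    using assms(2) unfolding homology_nonzero_iff[OF assms(1)] by blast
  show ?thesis
  proof (rule ccontr)
    assume "\<not> ?thesis"
    then have "x = 0" if "\<And>l. \<rho> l x = 0" for x using that by blast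
    then show False using acyclic[OF submodule_UNIV _ z] not_range by blast
  qed
qed

text \<open>
  If degree \<open>0\<close> had no homology, \<open>\<rho>(L) X\<close> would be all of \<open>X\<close>, which excludes nonzero invariant
  vectors.
\<close>

lemma homology_nonzero_bottom:
  fixes \<rho> :: "'l::complex_lie_algebra \<Rightarrow> 'x::complex_banach \<Rightarrow> 'x"
  assumes "nilpotent_lie_module \<rho>" "x \<noteq> 0" "\<And>l. \<rho> l x = 0"
  shows "homology_nonzero \<rho> 0"
proof -
  interpret nilpotent_lie_module \<rho> by fact
  let ?S = "cvec.span {\<rho> l x | l x. x \<in> UNIV}"
  have "\<not> UNIV \<subseteq> ?S"
    using coinvariants_zero_imp_invariants_zero[OF fdX fdL nilL submodule_UNIV] assms(2,3) by blast
  then obtain y where y: "y \<notin> ?S" by blast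
  have "single {} y \<in> chains TYPE('l) 0 UNIV"
    by (rule single_in_chains) (auto simp: indices_def cvec.subspace_UNIV)
  moreover from this have "koszul (single {} y) = 0" by (rule koszul_chains_0)
  moreover have "koszul w \<noteq> single {} y" for w
    using koszul_bottom[of w] y by (auto simp: single_def)
  ultimately show ?thesis unfolding homology_nonzero_iff[OF assms(1)] by blast
qed

lemma homology_nonzero_top:
  fixes \<rho> :: "'l::complex_lie_algebra \<Rightarrow> 'x::complex_banach \<Rightarrow> 'x"
  assumes "nilpotent_lie_module \<rho>" "x \<noteq> 0" "\<And>l. \<rho> l x = 0"
  shows "homology_nonzero \<rho> (cdim TYPE('l))"
proof -
  interpret nilpotent_lie_module \<rho> by fact
  let ?n = "cdim TYPE('l)"
  have "single {..<?n} x \<in> chains TYPE('l) ?n UNIV"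
    by (rule single_in_chains) (auto simp: indices_def cvec.subspace_UNIV)
  moreover have "koszul (single {..<?n} x) = 0" by (rule koszul_top[OF assms(3)])
  moreover have "koszul w \<noteq> single {..<?n} x" if "w \<in> chains TYPE('l) (Suc ?n) UNIV" for w
  proof -
    have "indices TYPE('l) (Suc ?n) = {}"
      by (auto simp: indices_def dest!: card_mono[OF finite_lessThan])
    then have "w = 0" using that by (auto simp: chains_def)
    moreover have "single {..<?n} x {..<?n} \<noteq> 0" using assms(2) by (simp add: single_def)
    ultimately show ?thesis by (metis cpair.linear_0[OF clinear_koszul] zero_fun_apply)
  qed
  ultimately show ?thesis unfolding homology_nonzero_iff[OF assms(1)] by blast
qed

theorem theorem3p4:
  fixes \<rho> :: "'l::complex_lie_algebra \<Rightarrow> 'x::complex_banach \<Rightarrow> 'x"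
  assumes "finite_dimensional TYPE('x)"
    and "finite_dimensional TYPE('l)"
    and "nilpotent TYPE('l)"
    and "representation \<rho>"
  shows "\<forall>k \<le> cdim TYPE('l).
     taylor_spectrum \<rho> = slodkowski_delta k \<rho> \<and>
     slodkowski_delta k \<rho> = slodkowski_pi k \<rho> \<and>
     slodkowski_pi k \<rho> = {f \<in> characters. \<exists>x. x \<noteq> 0 \<and> (\<forall>l. \<rho> l x = f l *\<^sub>C x)}"
proof (intro allI impI)
  fix k assume k: "k \<le> cdim TYPE('l)"
  let ?n = "cdim TYPE('l)"
  define E where "E = {f \<in> characters. \<exists>x. x \<noteq> 0 \<and> (\<forall>l. \<rho> l x = f l *\<^sub>C x)}"
  note module = nilpotent_lie_module_shift[OF assms]
  have upper: "sigma_p p \<rho> \<subseteq> E" for p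
    using homology_nonzero_imp_invariant[OF module, of _ p] by (auto simp: sigma_p_def E_def shift_def)
  have bottom: "E \<subseteq> sigma_p 0 \<rho>" and top: "E \<subseteq> sigma_p ?n \<rho>"
    using homology_nonzero_bottom[OF module] homology_nonzero_top[OF module]
    by (auto simp: sigma_p_def E_def shift_def)
  have closed: "{f \<in> characters. \<not> closed (koszul_range (shift \<rho> f) (?n - k))} = {}"
    using closed_koszul_range[OF module] by blast
  have "taylor_spectrum \<rho> = E"
    unfolding taylor_spectrum_def using upper bottom by fastforce
  moreover have "slodkowski_delta k \<rho> = E"
    unfolding slodkowski_delta_def using upper bottom by fastforce
  moreover have "slodkowski_pi k \<rho> = E"
    unfolding slodkowski_pi_def closed using upper top by fastforce
  ultimately show "taylor_spectrum \<rho> = slodkowski_delta k \<rho> \<and> slodkowski_delta k \<rho> = slodkowski_pi k \<rho> \<and>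
     slodkowski_pi k \<rho> = {f \<in> characters. \<exists>x. x \<noteq> 0 \<and> (\<forall>l. \<rho> l x = f l *\<^sub>C x)}"
    by (simp add: E_def)
qed

end
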